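(* Let $n\ge 1$, let $\pi\in S_n$ be a permutation and $a_1,\dots,a_n\in\mathbb{C}$, and let $E=E_{n,\pi}(a_1,\dots,a_n)$. If $E$ satisfies the condition $P$, then $E$ is isomorphic to one of the following pairwise non-isomorphic algebras: $$ES_1\oplus\mathbb{C}^{n-1},\qquad EN_s\oplus\mathbb{C}^{n-s}\ (1\le s\le n),\qquad ES_1\oplus EN_s\oplus\mathbb{C}^{n-s-1}\ (2\le s\le n-1).$$
   Context: All algebras are finite dimensional over $\mathbb{C}$ (not necessarily associative). An evolution algebra is an algebra $E$ admitting a basis $\{e_1,\dots,e_n\}$ (called a natural basis) with $e_i\cdot e_j=0$ for $i\ne j$. A natural basis of $E$ is any vector space basis whose distinct elements multiply to zero. Condition $P$: an evolution algebra $E$ satisfies the condition $P$ if every subalgebra $M$ of $E$ (linear subspace closed under multiplication) has a basis consisting of elements with pairwise zero products (a natural basis of $M$) which can be extended to a natural basis of $E$. $E_{n,\pi}(a_1,\dots,a_n)$ is the evolution algebra with basis $\{e_1,\dots,e_n\}$ and multiplication $e_i\cdot e_i=a_ie_{\pi(i)}$ for $1\le i\le n$, $e_i\cdot e_j=0$ for $i\neq j$ (the $a_i$ may be zero). $ES_1$ is the one-dimensional algebra with basis $\{e_1\}$ and $e_1\cdot e_1=e_1$. $EN_s$ is the $s$-dimensional evolution algebra with natural basis $\{e_1,\dots,e_s\}$ and $e_i\cdot e_i=e_{i+1}$ for $1\le i\le s-1$, $e_s\cdot e_s=0$. $\mathbb{C}^m$ denotes the $m$-dimensional algebra with zero multiplication,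 and $\oplus$ denotes the direct sum of algebras (products between different summands are zero). *)

theory Defs
  imports
    Complex_Main
    "HOL-Library.Function_Algebras"
    "HOL-Library.Product_Plus"
    "HOL-Combinatorics.Permutations"
begin

class complex_vector = ab_group_add +
  fixes scaleC :: "complex \<Rightarrow> 'a \<Rightarrow> 'a" (infixr "*\<^sub>C" 75)
  assumes scaleC_add_right: "c *\<^sub>C (x + y) = c *\<^sub>C x + c *\<^sub>C y"
    and scaleC_add_left: "(c + d) *\<^sub>C x = c *\<^sub>C x + d *\<^sub>C x"
    and scaleC_scaleC: "c *\<^sub>C (d *\<^sub>C x) = (c * d) *\<^sub>C x"
    and scaleC_one: "1 *\<^sub>C x = x"

global_interpretation complex_vector:
  vector_space "scaleC :: complex \<Rightarrow> 'a \<Rightarrow> 'a::complex_vector"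
  by unfold_locales (simp_all add: scaleC_add_right scaleC_add_left scaleC_scaleC scaleC_one)

instantiation complex :: complex_vector
begin
definition scaleC_complex :: "complex \<Rightarrow> complex \<Rightarrow> complex"
  where "scaleC_complex c x = c * x"
instance by standard (simp_all add: scaleC_complex_def algebra_simps)
end

instantiation "fun" :: (type, complex_vector) complex_vector
begin
definition scaleC_fun :: "complex \<Rightarrow> ('a \<Rightarrow> 'b) \<Rightarrow> 'a \<Rightarrow> 'b"
  where "scaleC_fun c f = (\<lambda>x. c *\<^sub>C f x)"
instance
  by standard
    (simp_all add: scaleC_fun_def fun_eq_iff scaleC_add_right scaleC_add_left scaleC_scaleC scaleC_one)
end

instantiation prod :: (complex_vector, complex_vector) complex_vector
begin
definition scaleC_prod :: "complex \<Rightarrow> 'a \<times> 'b \<Rightarrow> 'a \<times> 'b"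
  where "scaleC_prod c p = (c *\<^sub>C fst p, c *\<^sub>C snd p)"
instance
  by standard
    (simp_all add: scaleC_prod_def prod_eq_iff scaleC_add_right scaleC_add_left scaleC_scaleC scaleC_one)
end

text \<open>
  An algebra is carried by a linear subspace of an ambient complex vector space; the values of the
  multiplication outside the carrier are irrelevant.
\<close>

record 'a calg =
  calg_carrier :: "'a set"
  calg_mult :: "'a \<Rightarrow> 'a \<Rightarrow> 'a"

definition calgebra :: "('a::complex_vector) calg \<Rightarrow> bool" where
  "calgebra A \<longleftrightarrow>
     complex_vector.subspace (calg_carrier A) \<and>
     (\<exists>B. finite B \<and> complex_vector.span B = calg_carrier A) \<and>
     (\<forall>x\<in>calg_carrier A. \<forall>y\<in>calg_carrier A. calg_mult A x y \<in> calg_carrier A) \<and>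
     (\<forall>x\<in>calg_carrier A. \<forall>y\<in>calg_carrier A. \<forall>z\<in>calg_carrier A.
        calg_mult A (x + y) z = calg_mult A x z + calg_mult A y z \<and>
        calg_mult A x (y + z) = calg_mult A x y + calg_mult A x z) \<and>
     (\<forall>c. \<forall>x\<in>calg_carrier A. \<forall>y\<in>calg_carrier A.
        calg_mult A (c *\<^sub>C x) y = c *\<^sub>C calg_mult A x y \<and>
        calg_mult A x (c *\<^sub>C y) = c *\<^sub>C calg_mult A x y)"

definition natural_basis :: "('a::complex_vector) calg \<Rightarrow> 'a set \<Rightarrow> bool" where
  "natural_basis A B \<longleftrightarrow>
     \<not> complex_vector.dependent B \<and> complex_vector.span B = calg_carrier A \<and>
     (\<forall>x\<in>B. \<forall>y\<in>B. x \<noteq> y \<longrightarrow> calg_mult A x y = 0)"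

definition evolution_algebra :: "('a::complex_vector) calg \<Rightarrow> bool" where
  "evolution_algebra A \<longleftrightarrow> calgebra A \<and> (\<exists>B. natural_basis A B)"

definition subalgebra :: "'a set \<Rightarrow> ('a::complex_vector) calg \<Rightarrow> bool" where
  "subalgebra M A \<longleftrightarrow>
     M \<subseteq> calg_carrier A \<and> complex_vector.subspace M \<and>
     (\<forall>x\<in>M. \<forall>y\<in>M. calg_mult A x y \<in> M)"

definition condition_P :: "('a::complex_vector) calg \<Rightarrow> bool" where
  "condition_P E \<longleftrightarrow>
     (\<forall>M. subalgebra M E \<longrightarrow>
        (\<exists>B B'. natural_basis (E\<lparr>calg_carrier := M\<rparr>) B \<and> B \<subseteq> B' \<and> natural_basis E B'))"

definition calg_isomorphic ::
    "('a::complex_vector) calg \<Rightarrow> ('b::complex_vector) calg \<Rightarrow> bool" (infix "\<cong>\<^sub>A" 50) where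
  "A \<cong>\<^sub>A B \<longleftrightarrow>
     (\<exists>f. bij_betw f (calg_carrier A) (calg_carrier B) \<and>
        (\<forall>x\<in>calg_carrier A. \<forall>y\<in>calg_carrier A. f (x + y) = f x + f y) \<and>
        (\<forall>c. \<forall>x\<in>calg_carrier A. f (c *\<^sub>C x) = c *\<^sub>C f x) \<and>
        (\<forall>x\<in>calg_carrier A. \<forall>y\<in>calg_carrier A.
           f (calg_mult A x y) = calg_mult B (f x) (f y)))"

definition calg_sum ::
    "('a::complex_vector) calg \<Rightarrow> ('b::complex_vector) calg \<Rightarrow> ('a \<times> 'b) calg" (infixr "\<oplus>\<^sub>A" 65) where
  "A \<oplus>\<^sub>A B =
     \<lparr>calg_carrier = calg_carrier A \<times> calg_carrier B,
      calg_mult = (\<lambda>x y. (calg_mult A (fst x) (fst y), calg_mult B (snd x) (snd y)))\<rparr>"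

definition unit_fun :: "nat \<Rightarrow> nat \<Rightarrow> complex" where
  "unit_fun i = (\<lambda>k. if k = i then 1 else 0)"

text \<open>
  The \<open>n\<close>-dimensional evolution algebra with natural basis
  \<open>unit_fun 1, \<dots>, unit_fun n\<close>, realised on the functions supported in \<open>{1..n}\<close>, in which the
  square of \<open>unit_fun i\<close> is \<open>q i\<close>. It is closed under multiplication only if every \<open>q i\<close> is
  itself supported in \<open>{1..n}\<close>.
\<close>

definition evol_alg :: "nat \<Rightarrow> (nat \<Rightarrow> nat \<Rightarrow> complex) \<Rightarrow> (nat \<Rightarrow> complex) calg" where
  "evol_alg n q =
     \<lparr>calg_carrier = {x. \<forall>i. i \<notin> {1..n} \<longrightarrow> x i = 0},
      calg_mult = (\<lambda>x y. \<Sum>i=1..n. (x i * y i) *\<^sub>C q i)\<rparr>"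

definition E_perm :: "nat \<Rightarrow> (nat \<Rightarrow> nat) \<Rightarrow> (nat \<Rightarrow> complex) \<Rightarrow> (nat \<Rightarrow> complex) calg" where
  "E_perm n \<pi> a = evol_alg n (\<lambda>i. a i *\<^sub>C unit_fun (\<pi> i))"

definition ES1 :: "(nat \<Rightarrow> complex) calg" where
  "ES1 = evol_alg 1 (\<lambda>i. unit_fun 1)"

definition EN :: "nat \<Rightarrow> (nat \<Rightarrow> complex) calg" where
  "EN s = evol_alg s (\<lambda>i. if i < s then unit_fun (i + 1) else 0)"

definition Czero :: "nat \<Rightarrow> (nat \<Rightarrow> complex) calg" where
  "Czero m = evol_alg m (\<lambda>i. 0)"

lemma sum_fun_apply: "(\<Sum>i\<in>A. f i) k = (\<Sum>i\<in>A. f i k)"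
  for f :: "'i \<Rightarrow> 'a \<Rightarrow> 'b::comm_monoid_add"
  by (induction A rule: infinite_finite_induct) auto

lemma evol_alg_mult_unit:
  assumes "i \<in> {1..n}" "j \<in> {1..n}"
  shows "calg_mult (evol_alg n q) (unit_fun i) (unit_fun j) = (if i = j then q i else 0)"
proof -
  have "calg_mult (evol_alg n q) (unit_fun i) (unit_fun j)
      = (\<Sum>k=1..n. if k = i then (if i = j then q i else 0) else 0)"
    unfolding evol_alg_def calg.simps
    by (rule sum.cong) (auto simp: unit_fun_def scaleC_one)
  then show ?thesis using assms by simp
qed

lemma evol_alg_natural_basis: "natural_basis (evol_alg n q) (unit_fun ` {1..n})"
proof -
  let ?B = "unit_fun ` {1..n}" and ?V = "calg_carrier (evol_alg n q)"
  have inj: "inj_on unit_fun {1..n}"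
    by (auto simp: inj_on_def unit_fun_def fun_eq_iff split: if_splits)
  have expand: "(\<Sum>v\<in>?B. u v *\<^sub>C v) k = (if k \<in> {1..n} then u (unit_fun k) else 0)" for u k
  proof -
    have "(\<Sum>v\<in>?B. u v *\<^sub>C v) k = (\<Sum>i=1..n. if i = k then u (unit_fun i) else 0)"
      unfolding sum.reindex[OF inj] sum_fun_apply
      by (rule sum.cong) (auto simp: unit_fun_def scaleC_fun_def scaleC_complex_def)
    then show ?thesis by simp
  qed
  have indep: "\<not> complex_vector.dependent ?B"
  proof (subst complex_vector.dependent_finite)
    show "\<not> (\<exists>u. (\<exists>v\<in>?B. u v \<noteq> 0) \<and> (\<Sum>v\<in>?B. u v *\<^sub>C v) = 0)"
      using expand by (metis (no_types, lifting) imageE zero_fun_apply)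
  qed simp
  have "complex_vector.span ?B \<subseteq> ?V"
    by (auto simp: complex_vector.span_finite expand evol_alg_def simp del: One_nat_def)
  moreover have "?V \<subseteq> complex_vector.span ?B"
  proof
    fix x assume x: "x \<in> ?V"
    define u where "u v = x (the_inv_into {1..n} unit_fun v)" for v
    have "x = (\<Sum>v\<in>?B. u v *\<^sub>C v)"
    proof
      fix k show "x k = (\<Sum>v\<in>?B. u v *\<^sub>C v) k"
        using x unfolding expand u_def
        by (auto simp: the_inv_into_f_f[OF inj] evol_alg_def simp del: One_nat_def)
    qed
    then show "x \<in> complex_vector.span ?B"
      by (auto simp: complex_vector.span_finite)
  qed
  ultimately show ?thesis
    using indep by (auto simp: natural_basis_def evol_alg_mult_unit)
qed

lemma evol_alg_evolution_algebra:
  assumes "\<And>i. i \<in> {1..n} \<Longrightarrow> q i \<in> calg_carrier (evol_alg n q)"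
  shows "evolution_algebra (evol_alg n q)"
proof -
  have "calgebra (evol_alg n q)"
    unfolding calgebra_def
  proof (intro conjI)
    show "complex_vector.subspace (calg_carrier (evol_alg n q))"
      using evol_alg_natural_basis[of n q]
      by (metis complex_vector.subspace_span natural_basis_def)
    show "\<exists>B. finite B \<and> complex_vector.span B = calg_carrier (evol_alg n q)"
      using evol_alg_natural_basis[of n q] unfolding natural_basis_def by blast
  qed (use assms in \<open>auto simp: evol_alg_def fun_eq_iff sum_fun_apply scaleC_fun_def
         scaleC_complex_def sum.distrib sum_distrib_left algebra_simps\<close>)
  then show ?thesis
    using evol_alg_natural_basis evolution_algebra_def by blast
qed

lemma E_perm_evolution_algebra:
  assumes "\<pi> permutes {1..n}"
  shows "evolution_algebra (E_perm n \<pi> a)"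
  unfolding E_perm_def
proof (rule evol_alg_evolution_algebra)
  fix i assume "i \<in> {1..n}"
  then have "\<pi> i \<in> {1..n}" using permutes_in_image[OF assms] by blast
  then show "a i *\<^sub>C unit_fun (\<pi> i) \<in> calg_carrier (evol_alg n (\<lambda>i. a i *\<^sub>C unit_fun (\<pi> i)))"
    by (auto simp: evol_alg_def unit_fun_def scaleC_fun_def scaleC_complex_def)
qed

end

theory Submission
  imports Defs "HOL-Analysis.Complex_Transcendental"
begin

text \<open>
  Let \<open>S\<close> be the set of indices \<open>i\<close> with \<open>a i \<noteq> 0\<close>. As \<open>\<pi>\<close> is injective, multiplication by \<open>x\<close> on
  \<open>E_perm n \<pi> a\<close> has rank equal to the number of indices of \<open>S\<close> in the support of \<open>x\<close>. A member of a
  natural basis is annihilated by all the other members, so this rank is at most one for it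
  (\<open>natural_basis_elem_support\<close>). Under condition P every subalgebra is spanned by members of a
  natural basis of the whole algebra, hence by elements whose support meets \<open>S\<close> in at most one index
  (\<open>condition_P_small_support\<close>). Two kinds of subalgebras turn this into a restriction on the graph
  with an arrow from \<open>i\<close> to \<open>\<pi> i\<close> for every \<open>i \<in> S\<close>.

  The line through an idempotent \<open>u\<close> is a subalgebra, so the support of \<open>u\<close> meets \<open>S\<close> in at most one
  index. Since \<open>\<complex>\<close> is algebraically closed, each cycle of arrows carries an idempotent supported on the
  whole cycle; therefore cycles are loops. The sum of the idempotents of two loops is again an
  idempotent, so there is at most one loop.

  An arrow is last if its target does not lie in \<open>S\<close>. If \<open>p \<noteq> q\<close> both start last arrows and
  \<open>u = unit_fun p + unit_fun q\<close>, then \<open>u\<close> and its square span a subalgebra in which every element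
  outside the line of the square has both \<open>p\<close> and \<open>q\<close> in its support. So there is at most one last
  arrow, and all the arrows which do not lie on a cycle form one chain leading to it
  (\<open>unique_last_arrow_chain\<close>).

  The graph thus consists of at most one loop, at most one chain, and isolated points. Rescaling the
  basis vectors along the chain and at the loop makes all coefficients equal to one and gives the
  listed algebras.

  These are told apart by iterated squaring \<open>x \<mapsto> x \<cdot> x\<close>: a summand \<open>ES1\<close> is present if and only if some
  element is never annihilated by iterated squaring, and among the elements which are annihilated at
  some stage, the largest number of squarings that can be survived is \<open>s - 1\<close> for \<open>EN s\<close>.
\<close>

section \<open>Products in coordinates\<close>

lemma evol_alg_carrier: "x \<in> calg_carrier (evol_alg n q) \<longleftrightarrow> (\<forall>i. i \<notin> {1..n} \<longrightarrow> x i = 0)"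
  by (simp add: evol_alg_def)

lemma evol_alg_mult_apply:
  "calg_mult (evol_alg n q) x y j = (\<Sum>i=1..n. x i * y i * q i j)"
  by (simp add: evol_alg_def sum_fun_apply scaleC_fun_def scaleC_complex_def)

lemma E_perm_carrier: "x \<in> calg_carrier (E_perm n \<pi> a) \<longleftrightarrow> (\<forall>i. i \<notin> {1..n} \<longrightarrow> x i = 0)"
  by (simp add: E_perm_def evol_alg_carrier)

lemma E_perm_mult_apply:
  assumes "\<pi> permutes {1..n}" "i \<in> {1..n}"
  shows "calg_mult (E_perm n \<pi> a) x y (\<pi> i) = x i * y i * a i"
proof -
  have "calg_mult (E_perm n \<pi> a) x y (\<pi> i) = (\<Sum>k=1..n. if k = i then x i * y i * a i else 0)"
    unfolding E_perm_def evol_alg_mult_apply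
    using permutes_inj[OF assms(1)]
    by (intro sum.cong) (auto simp: scaleC_fun_def scaleC_complex_def unit_fun_def inj_eq)
  then show ?thesis using assms(2) by simp
qed

text \<open>
  Every coordinate in \<open>{1..n}\<close> is of the form \<open>\<pi> i\<close>, so it suffices to compare products at the images
  of \<open>\<pi>\<close>.
\<close>

lemma E_perm_mult_eqI:
  assumes \<pi>: "\<pi> permutes {1..n}" and z: "z \<in> calg_carrier (E_perm n \<pi> a)"
    and eq: "\<And>i. i \<in> {1..n} \<Longrightarrow> x i * y i * a i = z (\<pi> i)"
  shows "calg_mult (E_perm n \<pi> a) x y = z"
proof
  fix j
  show "calg_mult (E_perm n \<pi> a) x y j = z j"
  proof (cases "j \<in> {1..n}")
    case True
    then obtain i where "j = \<pi> i" "i \<in> {1..n}" using permutes_image[OF \<pi>] by blast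
    then show ?thesis using E_perm_mult_apply[OF \<pi>] eq by simp
  next
    case False
    have "j \<noteq> \<pi> i" if "i \<in> {1..n}" for i using permutes_in_image[OF \<pi>] that False by metis
    then have "calg_mult (E_perm n \<pi> a) x y j = 0"
      unfolding E_perm_def evol_alg_mult_apply
      by (intro sum.neutral) (simp add: scaleC_fun_def scaleC_complex_def unit_fun_def)
    then show ?thesis using z False by (simp add: E_perm_carrier)
  qed
qed

section \<open>Iterated squares as isomorphism invariants\<close>

definition square :: "'a calg \<Rightarrow> 'a \<Rightarrow> 'a" where
  "square A x = calg_mult A x x"

definition square_nil :: "('a::zero) calg \<Rightarrow> 'a \<Rightarrow> bool" where
  "square_nil A x \<longleftrightarrow> (\<exists>N. (square A ^^ N) x = 0)"

text \<open>
  Only the elements killed by some number of squarings are tested: otherwise a summand \<open>ES1\<close>, in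
  which no nonzero element is ever killed, would hide the length of the nilpotent part.
\<close>

definition nil_level :: "('a::zero) calg \<Rightarrow> nat \<Rightarrow> bool" where
  "nil_level A k \<longleftrightarrow>
     (\<exists>x\<in>calg_carrier A. square_nil A x \<and> (square A ^^ k) x \<noteq> 0)"

lemma iso_square_invariants:
  assumes iso: "A \<cong>\<^sub>A B"
    and closed: "\<And>x. x \<in> calg_carrier A \<Longrightarrow> square A x \<in> calg_carrier A"
    and zero: "0 \<in> calg_carrier A"
  shows "nil_level A k \<longleftrightarrow> nil_level B k"
    and "(\<forall>x\<in>calg_carrier A. square_nil A x) \<longleftrightarrow> (\<forall>y\<in>calg_carrier B. square_nil B y)"
proof -
  from iso obtain f where bij: "bij_betw f (calg_carrier A) (calg_carrier B)"
    and add: "\<forall>x\<in>calg_carrier A. \<forall>y\<in>calg_carrier A. f (x + y) = f x + f y"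
    and mult: "\<forall>x\<in>calg_carrier A. \<forall>y\<in>calg_carrier A. f (calg_mult A x y) = calg_mult B (f x) (f y)"
    unfolding calg_isomorphic_def by blast
  have "f 0 = f 0 + f 0" using add zero by (metis add_0)
  then have f0: "f 0 = 0" by simp
  have sq: "f (square A x) = square B (f x)" if "x \<in> calg_carrier A" for x
    using that mult by (simp add: square_def)
  have pow: "(square A ^^ m) x \<in> calg_carrier A \<and> f ((square A ^^ m) x) = (square B ^^ m) (f x)"
    if "x \<in> calg_carrier A" for m x
    using that by (induction m) (auto simp: closed sq)
  have pow0: "(square B ^^ m) (f x) = 0 \<longleftrightarrow> (square A ^^ m) x = 0" if "x \<in> calg_carrier A" for m x
    using pow[OF that, of m] f0 zero bij by (metis bij_betw_imp_inj_on inj_onD)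
  have B: "calg_carrier B = f ` calg_carrier A" using bij by (simp add: bij_betw_def)
  show "nil_level A k \<longleftrightarrow> nil_level B k"
    unfolding nil_level_def square_nil_def B by (simp add: pow0)
  show "(\<forall>x\<in>calg_carrier A. square_nil A x) \<longleftrightarrow> (\<forall>y\<in>calg_carrier B. square_nil B y)"
    unfolding square_nil_def B by (simp add: pow0)
qed

lemma calg_sum_carrier: "calg_carrier (A \<oplus>\<^sub>A B) = calg_carrier A \<times> calg_carrier B"
  by (simp add: calg_sum_def)

lemma calg_sum_mult:
  "calg_mult (A \<oplus>\<^sub>A B) (x, y) (x', y') = (calg_mult A x x', calg_mult B y y')"
  by (simp add: calg_sum_def)

lemma calg_sum_square_pow:
  "(square (A \<oplus>\<^sub>A B) ^^ k) (x, y) = ((square A ^^ k) x, (square B ^^ k) y)"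
  by (induction k) (auto simp: square_def calg_sum_mult)

lemma ES1_square_pow:
  assumes "x \<in> calg_carrier ES1"
  shows "(square ES1 ^^ k) x = (\<lambda>j. if j = 1 then x 1 ^ 2 ^ k else 0)"
proof (induction k)
  case 0
  show ?case using assms by (auto simp: ES1_def evol_alg_carrier fun_eq_iff simp del: One_nat_def)
next
  case (Suc k)
  then show ?case
    by (auto simp: square_def ES1_def evol_alg_mult_apply fun_eq_iff unit_fun_def
        power_mult power2_eq_square power_mult_distrib)
qed

lemma EN_square:
  "square (EN s) x j = (if 1 < j \<and> j \<le> s then x (j - 1) ^ 2 else 0)"
proof -
  have "square (EN s) x j = (\<Sum>i=1..s. if i = j - 1 then (if 1 < j \<and> j \<le> s then x (j - 1) ^ 2 else 0) else 0)"
    unfolding square_def EN_def evol_alg_mult_apply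
    by (rule sum.cong) (auto simp: unit_fun_def power2_eq_square)
  then show ?thesis by auto
qed

lemma EN_square_pow:
  assumes "x \<in> calg_carrier (EN s)"
  shows "(square (EN s) ^^ k) x j = (if k < j \<and> j \<le> s then x (j - k) ^ 2 ^ k else 0)"
proof (induction k arbitrary: j)
  case 0
  show ?case using assms by (auto simp: EN_def evol_alg_carrier simp del: One_nat_def)
next
  case (Suc k)
  then show ?case by (auto simp: EN_square power_mult[symmetric] mult.commute)
qed

lemma EN_square_pow_vanish:
  assumes "x \<in> calg_carrier (EN s)" "s \<le> k"
  shows "(square (EN s) ^^ k) x = 0"
  using assms by (auto simp: fun_eq_iff EN_square_pow)

lemma Czero_square: "square (Czero m) x = 0"
  by (auto simp: fun_eq_iff square_def Czero_def evol_alg_mult_apply)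

lemma Czero_square_pow_vanish:
  assumes "0 < k"
  shows "(square (Czero m) ^^ k) x = 0"
  using assms by (cases k) (simp_all add: Czero_square)

lemma Czero_square_pow_0: "(square (Czero m) ^^ k) 0 = 0"
  by (cases k) (simp_all add: Czero_square)

lemma ES1_square_pow_0: "(square ES1 ^^ k) 0 = 0"
  by (subst ES1_square_pow) (auto simp: ES1_def evol_alg_carrier)

text \<open>
  This is why a summand \<open>ES1\<close> does not contribute to the nilpotent levels.
\<close>

lemma ES1_square_nil:
  assumes "x \<in> calg_carrier ES1" "(square ES1 ^^ N) x = 0"
  shows "x = 0"
proof -
  have "x 1 ^ 2 ^ N = 0"
    using assms ES1_square_pow[of x N] by (metis zero_fun_apply)
  then show ?thesis
    using assms(1) by (auto simp: ES1_def evol_alg_carrier fun_eq_iff) metis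
qed

lemma EN_square_pow_unit:
  assumes "k < s"
  shows "(square (EN s) ^^ k) (unit_fun 1) \<noteq> 0"
proof
  assume "(square (EN s) ^^ k) (unit_fun 1) = 0"
  moreover have "(square (EN s) ^^ k) (unit_fun 1) (Suc k) = 1"
    using assms by (subst EN_square_pow) (auto simp: EN_def evol_alg_carrier unit_fun_def)
  ultimately show False by (simp add: fun_eq_iff)
qed

lemma unit_fun_in_EN: "1 \<le> s \<Longrightarrow> unit_fun 1 \<in> calg_carrier (EN s)"
  by (auto simp: EN_def evol_alg_carrier unit_fun_def)

lemma zero_in_carrier:
  "0 \<in> calg_carrier ES1" "0 \<in> calg_carrier (EN s)" "0 \<in> calg_carrier (Czero m)"
  by (simp_all add: ES1_def EN_def Czero_def evol_alg_carrier)

lemma square_closed: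
  "square ES1 x \<in> calg_carrier ES1" "square (EN s) y \<in> calg_carrier (EN s)"
  "square (Czero m) z \<in> calg_carrier (Czero m)"
  using zero_in_carrier(3)
  by (auto simp: ES1_def EN_def evol_alg_carrier square_def evol_alg_mult_apply
      unit_fun_def Czero_square[unfolded square_def] intro!: sum.neutral)

text \<open>
  The generator \<open>unit_fun 1\<close> moves one step along the chain with each squaring and so survives exactly
  \<open>s - 1\<close> of them, while \<open>s\<close> squarings kill everything.
\<close>

lemma nil_level_EN_sum:
  assumes "1 \<le> s"
  shows "nil_level (EN s \<oplus>\<^sub>A Czero m) k \<longleftrightarrow> k < s"
proof
  assume "nil_level (EN s \<oplus>\<^sub>A Czero m) k"
  then obtain x y where "x \<in> calg_carrier (EN s)" "(square (EN s \<oplus>\<^sub>A Czero m) ^^ k) (x, y) \<noteq> 0"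
    by (auto simp: nil_level_def calg_sum_carrier)
  then show "k < s"
    using assms EN_square_pow_vanish[of x s k] Czero_square_pow_vanish[of k m y]
    by (force simp: calg_sum_square_pow zero_prod_def)
next
  assume "k < s"
  then show "nil_level (EN s \<oplus>\<^sub>A Czero m) k"
    unfolding nil_level_def square_nil_def using assms
    by (intro bexI[of _ "(unit_fun 1, 0)"] conjI exI[of _ s])
      (simp_all add: calg_sum_square_pow calg_sum_carrier zero_prod_def EN_square_pow_vanish
        Czero_square_pow_0 EN_square_pow_unit[unfolded One_nat_def]
        unit_fun_in_EN[unfolded One_nat_def] zero_in_carrier)
qed

lemma nil_level_ES1_EN_sum:
  assumes "1 \<le> s"
  shows "nil_level (ES1 \<oplus>\<^sub>A EN s \<oplus>\<^sub>A Czero m) k \<longleftrightarrow> k < s"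
proof
  assume "nil_level (ES1 \<oplus>\<^sub>A EN s \<oplus>\<^sub>A Czero m) k"
  then obtain v x y N where v: "v \<in> calg_carrier ES1" "(square ES1 ^^ N) v = 0"
    and x: "x \<in> calg_carrier (EN s)"
    and *: "(square (ES1 \<oplus>\<^sub>A EN s \<oplus>\<^sub>A Czero m) ^^ k) (v, x, y) \<noteq> 0"
    by (auto simp: nil_level_def square_nil_def calg_sum_carrier calg_sum_square_pow zero_prod_def)
  show "k < s"
    using * x assms EN_square_pow_vanish[of x s k] Czero_square_pow_vanish[of k m y]
      ES1_square_nil[OF v]
    by (force simp: calg_sum_square_pow zero_prod_def ES1_square_pow_0)
next
  assume "k < s"
  then show "nil_level (ES1 \<oplus>\<^sub>A EN s \<oplus>\<^sub>A Czero m) k"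
    unfolding nil_level_def square_nil_def using assms
    by (intro bexI[of _ "(0, unit_fun 1, 0)"] conjI exI[of _ s])
      (simp_all add: calg_sum_square_pow calg_sum_carrier zero_prod_def EN_square_pow_vanish
        Czero_square_pow_0 ES1_square_pow_0 EN_square_pow_unit[unfolded One_nat_def]
        unit_fun_in_EN[unfolded One_nat_def] zero_in_carrier)
qed

lemma not_nil_level_ES1_sum: "\<not> nil_level (ES1 \<oplus>\<^sub>A Czero m) 1"
proof
  assume "nil_level (ES1 \<oplus>\<^sub>A Czero m) 1"
  then obtain v y N where v: "v \<in> calg_carrier ES1" "(square ES1 ^^ N) v = 0"
    and *: "(square (ES1 \<oplus>\<^sub>A Czero m) ^^ 1) (v, y) \<noteq> 0"
    by (auto simp: nil_level_def square_nil_def calg_sum_carrier calg_sum_square_pow zero_prod_def)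
  show False
    using * ES1_square_pow_0[of 1] ES1_square_nil[OF v] Czero_square_pow_vanish[of 1 m y]
    unfolding calg_sum_square_pow by (simp add: zero_prod_def)
qed

lemma EN_sum_square_nil:
  assumes "1 \<le> s" "x \<in> calg_carrier (EN s \<oplus>\<^sub>A Czero m)"
  shows "square_nil (EN s \<oplus>\<^sub>A Czero m) x"
  unfolding square_nil_def using assms
  by (intro exI[of _ s])
    (auto simp: calg_sum_square_pow calg_sum_carrier zero_prod_def EN_square_pow_vanish
      Czero_square_pow_vanish)

lemma ES1_sum_not_square_nil:
  assumes "0 \<in> calg_carrier A"
  shows "\<exists>x\<in>calg_carrier (ES1 \<oplus>\<^sub>A A). \<not> square_nil (ES1 \<oplus>\<^sub>A A) x"
proof (intro bexI notI)
  have mem: "unit_fun 1 \<in> calg_carrier ES1"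
    by (auto simp: ES1_def evol_alg_carrier unit_fun_def)
  then show "(unit_fun 1, 0) \<in> calg_carrier (ES1 \<oplus>\<^sub>A A)"
    using assms by (simp add: calg_sum_carrier)
  assume "square_nil (ES1 \<oplus>\<^sub>A A) (unit_fun 1, 0)"
  then obtain N where "(square ES1 ^^ N) (unit_fun 1) = 0"
    by (auto simp: square_nil_def calg_sum_square_pow zero_prod_def)
  then have "unit_fun 1 = 0" by (rule ES1_square_nil[OF mem])
  then have "unit_fun 1 1 = 0" by simp
  then show False by (simp add: unit_fun_def)
qed

lemma calg_sum_square_closed:
  assumes "\<And>x. square A x \<in> calg_carrier A" and "\<And>y. square B y \<in> calg_carrier B"
  shows "square (A \<oplus>\<^sub>A B) z \<in> calg_carrier (A \<oplus>\<^sub>A B)"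
  using assms by (auto simp: calg_sum_def square_def)

text \<open>
  Whether all elements are nil detects \<open>ES1\<close>, and the nilpotent levels detect the parameter of \<open>EN\<close>.
  The algebra \<open>ES1\<close> plus zero multiplication fits into the second pattern because its only possible
  nilpotent level is \<open>0\<close>.
\<close>

lemma models_non_isomorphic:
  shows "1 \<le> s \<Longrightarrow> \<not> ES1 \<oplus>\<^sub>A Czero l \<cong>\<^sub>A EN s \<oplus>\<^sub>A Czero m"
    and "2 \<le> s \<Longrightarrow> \<not> ES1 \<oplus>\<^sub>A Czero l \<cong>\<^sub>A ES1 \<oplus>\<^sub>A EN s \<oplus>\<^sub>A Czero m"
    and "1 \<le> s \<Longrightarrow> \<not> EN s \<oplus>\<^sub>A Czero l \<cong>\<^sub>A ES1 \<oplus>\<^sub>A EN t \<oplus>\<^sub>A Czero m"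
    and "1 \<le> s \<Longrightarrow> 1 \<le> t \<Longrightarrow> s \<noteq> t \<Longrightarrow> \<not> EN s \<oplus>\<^sub>A Czero l \<cong>\<^sub>A EN t \<oplus>\<^sub>A Czero m"
    and "1 \<le> s \<Longrightarrow> 1 \<le> t \<Longrightarrow> s \<noteq> t \<Longrightarrow>
      \<not> ES1 \<oplus>\<^sub>A EN s \<oplus>\<^sub>A Czero l \<cong>\<^sub>A ES1 \<oplus>\<^sub>A EN t \<oplus>\<^sub>A Czero m"
proof -
  note zero = calg_sum_carrier zero_prod_def zero_in_carrier
  have c: "square (ES1 \<oplus>\<^sub>A Czero l) x \<in> calg_carrier (ES1 \<oplus>\<^sub>A Czero l)"
    if "x \<in> calg_carrier (ES1 \<oplus>\<^sub>A Czero l)" for x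
    by (intro calg_sum_square_closed square_closed)
  have z: "0 \<in> calg_carrier (ES1 \<oplus>\<^sub>A Czero l)"
    by (simp add: zero)
  note ES1_Czero = iso_square_invariants[OF _ c z]
  have c: "square (EN s \<oplus>\<^sub>A Czero l) x \<in> calg_carrier (EN s \<oplus>\<^sub>A Czero l)"
    if "x \<in> calg_carrier (EN s \<oplus>\<^sub>A Czero l)" for x
    by (intro calg_sum_square_closed square_closed)
  have z: "0 \<in> calg_carrier (EN s \<oplus>\<^sub>A Czero l)"
    by (simp add: zero)
  note EN_Czero = iso_square_invariants[OF _ c z]
  have c: "square (ES1 \<oplus>\<^sub>A EN s \<oplus>\<^sub>A Czero l) x \<in> calg_carrier (ES1 \<oplus>\<^sub>A EN s \<oplus>\<^sub>A Czero l)"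
    if "x \<in> calg_carrier (ES1 \<oplus>\<^sub>A EN s \<oplus>\<^sub>A Czero l)" for x
    by (intro calg_sum_square_closed square_closed)
  have z: "0 \<in> calg_carrier (ES1 \<oplus>\<^sub>A EN s \<oplus>\<^sub>A Czero l)"
    by (simp add: zero)
  note ES1_EN_Czero = iso_square_invariants[OF _ c z]
  show "1 \<le> s \<Longrightarrow> \<not> ES1 \<oplus>\<^sub>A Czero l \<cong>\<^sub>A EN s \<oplus>\<^sub>A Czero m"
    using ES1_Czero(2) EN_sum_square_nil[of s] ES1_sum_not_square_nil zero_in_carrier by metis
  show "2 \<le> s \<Longrightarrow> \<not> ES1 \<oplus>\<^sub>A Czero l \<cong>\<^sub>A ES1 \<oplus>\<^sub>A EN s \<oplus>\<^sub>A Czero m"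
    using ES1_Czero(1)[where k = 1] nil_level_ES1_EN_sum[of s m 1] not_nil_level_ES1_sum[of l] by fastforce
  show "1 \<le> s \<Longrightarrow> \<not> EN s \<oplus>\<^sub>A Czero l \<cong>\<^sub>A ES1 \<oplus>\<^sub>A EN t \<oplus>\<^sub>A Czero m"
    using EN_Czero(2)[where B = "ES1 \<oplus>\<^sub>A EN t \<oplus>\<^sub>A Czero m"] EN_sum_square_nil[of s]
      ES1_sum_not_square_nil[of "EN t \<oplus>\<^sub>A Czero m"] by (auto simp: zero)
  show "1 \<le> s \<Longrightarrow> 1 \<le> t \<Longrightarrow> s \<noteq> t \<Longrightarrow> \<not> EN s \<oplus>\<^sub>A Czero l \<cong>\<^sub>A EN t \<oplus>\<^sub>A Czero m"
    using EN_Czero(1) nil_level_EN_sum by (metis less_irrefl linorder_neqE_nat)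
  show "1 \<le> s \<Longrightarrow> 1 \<le> t \<Longrightarrow> s \<noteq> t \<Longrightarrow>
      \<not> ES1 \<oplus>\<^sub>A EN s \<oplus>\<^sub>A Czero l \<cong>\<^sub>A ES1 \<oplus>\<^sub>A EN t \<oplus>\<^sub>A Czero m"
    using ES1_EN_Czero(1) nil_level_ES1_EN_sum by (metis less_irrefl linorder_neqE_nat)
qed

section \<open>Isomorphisms by relabelling, rescaling and splitting a natural basis\<close>

lemma calg_isomorphic_trans:
  assumes "A \<cong>\<^sub>A B" "B \<cong>\<^sub>A C"
  shows "A \<cong>\<^sub>A C"
proof -
  from assms(1) obtain f where f: "bij_betw f (calg_carrier A) (calg_carrier B)"
    "\<forall>x\<in>calg_carrier A. \<forall>y\<in>calg_carrier A. f (x + y) = f x + f y"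
    "\<forall>c. \<forall>x\<in>calg_carrier A. f (c *\<^sub>C x) = c *\<^sub>C f x"
    "\<forall>x\<in>calg_carrier A. \<forall>y\<in>calg_carrier A. f (calg_mult A x y) = calg_mult B (f x) (f y)"
    unfolding calg_isomorphic_def by blast
  from assms(2) obtain g where g: "bij_betw g (calg_carrier B) (calg_carrier C)"
    "\<forall>x\<in>calg_carrier B. \<forall>y\<in>calg_carrier B. g (x + y) = g x + g y"
    "\<forall>c. \<forall>x\<in>calg_carrier B. g (c *\<^sub>C x) = c *\<^sub>C g x"
    "\<forall>x\<in>calg_carrier B. \<forall>y\<in>calg_carrier B. g (calg_mult B x y) = calg_mult C (g x) (g y)"
    unfolding calg_isomorphic_def by blast
  have "f x \<in> calg_carrier B" if "x \<in> calg_carrier A" for x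
    using f(1) that by (auto simp: bij_betw_def)
  then show ?thesis
    unfolding calg_isomorphic_def using f g bij_betw_trans[OF f(1) g(1)]
    by (intro exI[of _ "g \<circ> f"]) auto
qed

lemma calg_sum_isomorphic_right:
  assumes "B \<cong>\<^sub>A C"
  shows "A \<oplus>\<^sub>A B \<cong>\<^sub>A A \<oplus>\<^sub>A C"
proof -
  from assms obtain g where g: "bij_betw g (calg_carrier B) (calg_carrier C)"
    "\<forall>x\<in>calg_carrier B. \<forall>y\<in>calg_carrier B. g (x + y) = g x + g y"
    "\<forall>c. \<forall>x\<in>calg_carrier B. g (c *\<^sub>C x) = c *\<^sub>C g x"
    "\<forall>x\<in>calg_carrier B. \<forall>y\<in>calg_carrier B. g (calg_mult B x y) = calg_mult C (g x) (g y)"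
    unfolding calg_isomorphic_def by blast
  have "bij_betw (map_prod id g) (calg_carrier A \<times> calg_carrier B) (calg_carrier A \<times> calg_carrier C)"
    using bij_betw_map_prod[OF bij_betw_id g(1)] .
  then show ?thesis
    unfolding calg_isomorphic_def using g
    by (intro exI[of _ "map_prod id g"]) (auto simp: calg_sum_def scaleC_prod_def)
qed

text \<open>
  The vectors \<open>d i *\<^sub>C unit_fun (h i)\<close> form a new natural basis, and \<open>q'\<close> lists their squares in the
  new coordinates. The equation relating \<open>q\<close> and \<open>q'\<close> is kept free of divisions.
\<close>

lemma evol_alg_relabel:
  assumes h: "bij_betw h {1..n} {1..n}"
    and d: "\<And>i. i \<in> {1..n} \<Longrightarrow> d i \<noteq> 0"
    and q: "\<And>i j. i \<in> {1..n} \<Longrightarrow> j \<in> {1..n} \<Longrightarrow> d i ^ 2 * q (h i) (h j) = q' i j * d j"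
    and q': "\<And>i. i \<in> {1..n} \<Longrightarrow> q' i \<in> calg_carrier (evol_alg n q')"
  shows "evol_alg n q \<cong>\<^sub>A evol_alg n q'"
proof -
  define f where "f x = (\<lambda>i. if i \<in> {1..n} then x (h i) / d i else 0)" for x :: "nat \<Rightarrow> complex"
  define g where "g y = (\<lambda>k. if k \<in> {1..n} then y (inv_into {1..n} h k) * d (inv_into {1..n} h k) else 0)"
    for y :: "nat \<Rightarrow> complex"
  have hin: "h i \<in> {1..n}" if "i \<in> {1..n}" for i using h that by (auto simp: bij_betw_def)
  have inv1: "inv_into {1..n} h (h i) = i" if "i \<in> {1..n}" for i
    using h that by (simp add: bij_betw_inv_into_left)
  have inv2: "h (inv_into {1..n} h k) = k" "inv_into {1..n} h k \<in> {1..n}" if "k \<in> {1..n}" for k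
    using h that by (auto simp: bij_betw_inv_into_right bij_betw_def inv_into_into simp del: atLeastAtMost_iff)
  have bij: "bij_betw f (calg_carrier (evol_alg n q)) (calg_carrier (evol_alg n q'))"
  proof (rule bij_betwI[where g = g])
    show "g (f x) = x" if "x \<in> calg_carrier (evol_alg n q)" for x
      using that inv2 d by (auto simp: f_def g_def evol_alg_carrier fun_eq_iff simp del: atLeastAtMost_iff)
    show "f (g y) = y" if "y \<in> calg_carrier (evol_alg n q')" for y
      using that inv1 hin d by (auto simp: f_def g_def evol_alg_carrier fun_eq_iff simp del: atLeastAtMost_iff)
  qed (auto simp: f_def g_def evol_alg_carrier)
  have "f (calg_mult (evol_alg n q) x y) j = calg_mult (evol_alg n q') (f x) (f y) j" for x y j
  proof (cases "j \<in> {1..n}")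
    case True
    have "f (calg_mult (evol_alg n q) x y) j = (\<Sum>i=1..n. x (h i) * y (h i) * q (h i) (h j)) / d j"
      using True sum.reindex_bij_betw[OF h, of "\<lambda>i. x i * y i * q i (h j)"]
      by (simp add: f_def evol_alg_mult_apply)
    also have "\<dots> = (\<Sum>i=1..n. f x i * f y i * q' i j)"
      unfolding sum_divide_distrib
    proof (rule sum.cong)
      fix i assume i: "i \<in> {1..n}"
      have "q (h i) (h j) / d j = q' i j / d i ^ 2"
        using q[OF i True] d[OF i] d[OF True] by (simp add: field_simps)
      then have "x (h i) * y (h i) * (q (h i) (h j) / d j) = x (h i) * y (h i) * (q' i j / d i ^ 2)"
        by simp
      then show "x (h i) * y (h i) * q (h i) (h j) / d j = f x i * f y i * q' i j"
        using i by (simp add: f_def power2_eq_square)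
    qed simp
    finally show ?thesis by (simp add: evol_alg_mult_apply)
  next
    case False
    then show ?thesis
      using q' by (auto simp: f_def evol_alg_mult_apply evol_alg_carrier intro!: sum.neutral[symmetric])
  qed
  then show ?thesis
    unfolding calg_isomorphic_def using bij
    by (intro exI[of _ f]) (auto simp: fun_eq_iff f_def add_divide_distrib scaleC_fun_def scaleC_complex_def)
qed

definition shift :: "nat \<Rightarrow> (nat \<Rightarrow> complex) \<Rightarrow> nat \<Rightarrow> complex" where
  "shift m x = (\<lambda>i. if m < i then x (i - m) else 0)"

text \<open>
  If the first \<open>m\<close> basis vectors and the last \<open>k\<close> ones span subalgebras, then the algebra is the direct
  sum of these, because products between the two blocks of a natural basis vanish.
\<close>

lemma evol_alg_split:
  assumes p: "\<And>i. i \<in> {1..m} \<Longrightarrow> p i \<in> calg_carrier (evol_alg m p)"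
    and r: "\<And>i. i \<in> {1..k} \<Longrightarrow> r i \<in> calg_carrier (evol_alg k r)"
  shows "evol_alg (m + k) (\<lambda>i. if i \<le> m then p i else shift m (r (i - m)))
           \<cong>\<^sub>A evol_alg m p \<oplus>\<^sub>A evol_alg k r" (is "evol_alg _ ?q \<cong>\<^sub>A _")
proof -
  define f where "f x = (\<lambda>i. if i \<le> m then x i else 0, \<lambda>i. if 0 < i then x (m + i) else 0)"
    for x :: "nat \<Rightarrow> complex"
  define g where "g z = (\<lambda>i. if i \<le> m then fst z i else snd z (i - m))"
    for z :: "(nat \<Rightarrow> complex) \<times> (nat \<Rightarrow> complex)"
  have bij: "bij_betw f (calg_carrier (evol_alg (m + k) ?q)) (calg_carrier (evol_alg m p \<oplus>\<^sub>A evol_alg k r))"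
  proof (rule bij_betwI[where g = g])
    show "f (g z) = z" if "z \<in> calg_carrier (evol_alg m p \<oplus>\<^sub>A evol_alg k r)" for z
      using that by (cases z) (auto simp: f_def g_def evol_alg_carrier calg_sum_carrier fun_eq_iff)
    show "g \<in> calg_carrier (evol_alg m p \<oplus>\<^sub>A evol_alg k r) \<rightarrow> calg_carrier (evol_alg (m + k) ?q)"
    proof
      fix z assume "z \<in> calg_carrier (evol_alg m p \<oplus>\<^sub>A evol_alg k r)"
      moreover have "\<not> i - m \<le> k" if "\<not> i \<le> m + k" for i using that by linarith
      ultimately show "g z \<in> calg_carrier (evol_alg (m + k) ?q)"
        by (auto simp: g_def evol_alg_carrier calg_sum_carrier)
    qed
  qed (auto simp: f_def g_def evol_alg_carrier calg_sum_carrier fun_eq_iff)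
  have split: "(\<Sum>i=1..m + k. F i) = (\<Sum>i=1..m. F i) + (\<Sum>i=1..k. F (m + i))" for F :: "nat \<Rightarrow> complex"
  proof -
    have "(\<Sum>i=1..m + k. F i) = (\<Sum>i=1..m. F i) + (\<Sum>i=m+1..m + k. F i)"
      by (rule sum.ub_add_nat) simp
    also have "(\<Sum>i=m+1..m + k. F i) = (\<Sum>i=1..k. F (m + i))"
      using sum.shift_bounds_cl_nat_ivl[of F 1 m k] by (simp add: add.commute)
    finally show ?thesis .
  qed
  have left: "calg_mult (evol_alg (m + k) ?q) x y j = calg_mult (evol_alg m p) (fst (f x)) (fst (f y)) j"
    if "j \<le> m" for x y j
    using that unfolding evol_alg_mult_apply split
    by (auto simp: f_def shift_def intro!: sum.cong)
  have p0: "p i (m + j) = 0" if "i \<in> {1..m}" "0 < j" for i j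
    using p[OF that(1)] that(2) by (simp add: evol_alg_carrier)
  have right: "calg_mult (evol_alg (m + k) ?q) x y (m + j) = calg_mult (evol_alg k r) (snd (f x)) (snd (f y)) j"
    if "0 < j" for x y j
    using that p0 unfolding evol_alg_mult_apply split
    by (auto simp: f_def shift_def intro!: sum.cong sum.neutral)
  have left0: "calg_mult (evol_alg m p) x y j = 0" if "\<not> j \<le> m" for x y j
    using that p by (auto simp: evol_alg_mult_apply evol_alg_carrier)
  have right0: "calg_mult (evol_alg k r) x y 0 = 0" for x y
    using r by (auto simp: evol_alg_mult_apply evol_alg_carrier)
  have "f (calg_mult (evol_alg (m + k) ?q) x y) =
      (calg_mult (evol_alg m p) (fst (f x)) (fst (f y)), calg_mult (evol_alg k r) (snd (f x)) (snd (f y)))"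
    for x y
    unfolding f_def[of "calg_mult _ x y"] using left right left0 right0 by (auto simp: fun_eq_iff)
  then show ?thesis
    unfolding calg_isomorphic_def using bij
    by (intro exI[of _ f])
      (auto simp: f_def fun_eq_iff scaleC_fun_def scaleC_complex_def scaleC_prod_def calg_sum_def)
qed

lemma injection_extends_to_bijection:
  assumes "inj_on g A" "g ` A \<subseteq> B" "A \<subseteq> B" "finite B"
  obtains h where "bij_betw h B B" "\<And>i. i \<in> A \<Longrightarrow> h i = g i"
proof -
  have "finite A" "finite (g ` A)" using assms finite_subset by blast+
  then have "card (B - A) = card (B - g ` A)"
    using assms by (simp add: card_Diff_subset card_image)
  then obtain g' where g': "bij_betw g' (B - A) (B - g ` A)"
    using assms(4) finite_same_card_bij by (metis finite_Diff)
  define h where "h i = (if i \<in> A then g i else g' i)" for i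
  have "bij_betw h A (g ` A)"
    using inj_on_imp_bij_betw[OF assms(1)] bij_betw_cong[of A h g] by (simp add: h_def)
  moreover have "bij_betw h (B - A) (B - g ` A)"
    using g' bij_betw_cong[of "B - A" h g'] by (simp add: h_def)
  ultimately have "bij_betw h (A \<union> (B - A)) (g ` A \<union> (B - g ` A))"
    by (rule bij_betw_combine) blast
  then show ?thesis
    using that[of h] assms(2,3) by (simp add: h_def Un_absorb1 Un_Diff_cancel)
qed

text \<open>
  Outside the part of the basis enumerated by \<open>g\<close> all squares vanish, so any bijective completion of
  \<open>g\<close> to the whole index set has the same multiplication table. The condition \<open>d i ^ 2 * a (g i) = d t\<close>
  says that the square of the \<open>i\<close>-th rescaled vector is the \<open>t\<close>-th one with coefficient one.
\<close>

lemma E_perm_relabel: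
  assumes \<pi>: "\<pi> permutes {1..n}" and mn: "m \<le> n"
    and inj: "inj_on g {1..m}" and g: "g ` {1..m} \<subseteq> {1..n}"
    and supp: "\<And>i. i \<in> {1..n} \<Longrightarrow> a i \<noteq> 0 \<Longrightarrow> i \<in> g ` {1..m}"
    and d: "\<And>i. i \<in> {1..m} \<Longrightarrow> d i \<noteq> 0"
    and q: "\<And>i. i \<in> {1..m} \<Longrightarrow> a (g i) = 0 \<and> q i = 0 \<or>
       (\<exists>t\<in>{1..m}. q i = unit_fun t \<and> \<pi> (g i) = g t \<and> d i ^ 2 * a (g i) = d t)"
    and q0: "\<And>i. i > m \<Longrightarrow> q i = 0"
  shows "E_perm n \<pi> a \<cong>\<^sub>A evol_alg n q"
proof -
  obtain h where h: "bij_betw h {1..n} {1..n}" and hg: "\<And>i. i \<in> {1..m} \<Longrightarrow> h i = g i"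
    using injection_extends_to_bijection[OF inj g] mn by (metis atLeastatMost_subset_iff finite_atLeastAtMost le_refl)
  have hinj: "h i = h j \<longleftrightarrow> i = j" if "i \<in> {1..n}" "j \<in> {1..n}" for i j
    using h that by (meson bij_betw_imp_inj_on inj_on_eq_iff)
  have a0: "a (h i) = 0" if i: "i \<in> {1..n}" "i > m" for i
  proof (rule ccontr)
    assume "a (h i) \<noteq> 0"
    moreover have "h i \<in> {1..n}" using h i by (auto simp: bij_betw_def)
    ultimately obtain k where k: "k \<in> {1..m}" "h i = h k" using supp hg by (metis imageE)
    then have "i = k" using hinj[of i k] i mn by simp
    then show False using k i by simp
  qed
  define d' where "d' i = (if i \<le> m then d i else 1)" for i
  show ?thesis
    unfolding E_perm_def
  proof (rule evol_alg_relabel[OF h, where d = d'])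
    show "d' i \<noteq> 0" if "i \<in> {1..n}" for i using that d by (simp add: d'_def)
    show "q i \<in> calg_carrier (evol_alg n q)" if "i \<in> {1..n}" for i
      using q[of i] q0[of i] that mn
      by (cases "i \<le> m") (auto simp: evol_alg_carrier unit_fun_def)
    fix i j assume i: "i \<in> {1..n}" and j: "j \<in> {1..n}"
    show "d' i ^ 2 * (a (h i) *\<^sub>C unit_fun (\<pi> (h i))) (h j) = q i j * d' j"
    proof (cases "i \<le> m")
      case False
      then show ?thesis using a0 i q0 by (simp add: scaleC_fun_def scaleC_complex_def)
    next
      case True
      then have i': "i \<in> {1..m}" using i by simp
      from q[OF this] show ?thesis
      proof
        assume "a (g i) = 0 \<and> q i = 0"
        then show ?thesis by (simp add: hg[OF i'] scaleC_fun_def scaleC_complex_def)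
      next
        assume "\<exists>t\<in>{1..m}. q i = unit_fun t \<and> \<pi> (g i) = g t \<and> d i ^ 2 * a (g i) = d t"
        then obtain t where t: "t \<in> {1..m}" "q i = unit_fun t" "\<pi> (h i) = h t" "d i ^ 2 * a (h i) = d t"
          using hg i' by metis
        have "h j = h t \<longleftrightarrow> j = t" using hinj[OF j, of t] t(1) mn by simp
        then show ?thesis using t True
          by (auto simp: d'_def unit_fun_def scaleC_fun_def scaleC_complex_def)
      qed
    qed
  qed
qed

section \<open>Consequences of condition P\<close>

text \<open>
  If \<open>x\<close> were nonzero at two such indices \<open>p \<noteq> q\<close>, all other members of the basis would vanish at \<open>p\<close> and
  \<open>q\<close>, since they annihilate \<open>x\<close>. Then \<open>B\<close> would project onto a line in the coordinate plane of \<open>p\<close> and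
  \<open>q\<close> and could not span the algebra.
\<close>

lemma natural_basis_elem_support:
  assumes \<pi>: "\<pi> permutes {1..n}" and B: "natural_basis (E_perm n \<pi> a) B" and x: "x \<in> B"
    and p: "p \<in> {1..n}" "a p \<noteq> 0" "x p \<noteq> 0" and q: "q \<in> {1..n}" "a q \<noteq> 0" "x q \<noteq> 0"
  shows "p = q"
proof (rule ccontr)
  assume "p \<noteq> q"
  \<comment> \<open>The vectors whose projection to the coordinates \<open>p\<close>, \<open>q\<close> is proportional to that of \<open>x\<close>.\<close>
  define K where "K = {y::nat \<Rightarrow> complex. x q * y p = x p * y q}"
  have "complex_vector.subspace K"
    unfolding K_def complex_vector.subspace_def
    by (auto simp: scaleC_fun_def scaleC_complex_def algebra_simps)
  moreover have "B \<subseteq> K"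
  proof
    fix v assume v: "v \<in> B"
    show "v \<in> K"
    proof (cases "v = x")
      case True
      then show ?thesis by (simp add: K_def)
    next
      case False
      then have "calg_mult (E_perm n \<pi> a) x v = 0"
        using B v x by (auto simp: natural_basis_def)
      then have "x i * v i * a i = 0" if "i \<in> {1..n}" for i
        using E_perm_mult_apply[OF \<pi> that, of a x v] by simp
      from this[OF p(1)] this[OF q(1)] show ?thesis using p q by (simp add: K_def)
    qed
  qed
  ultimately have "calg_carrier (E_perm n \<pi> a) \<subseteq> K"
    using B complex_vector.span_minimal unfolding natural_basis_def by metis
  moreover have "unit_fun p \<in> calg_carrier (E_perm n \<pi> a)"
    using p by (auto simp: E_perm_carrier unit_fun_def)
  ultimately have "unit_fun p \<in> K" by blast
  then show False using q \<open>p \<noteq> q\<close> by (auto simp: K_def unit_fun_def)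
qed

text \<open>
  The natural basis of \<open>M\<close> supplied by condition P spans \<open>M\<close>, so it cannot lie inside \<open>N\<close>; it is also
  part of a natural basis of the whole algebra, which bounds the supports of its members. The subspace
  \<open>N\<close> serves to select an element of \<open>M\<close> that is not degenerate.
\<close>

lemma condition_P_small_support:
  assumes \<pi>: "\<pi> permutes {1..n}" and P: "condition_P (E_perm n \<pi> a)"
    and M: "subalgebra M (E_perm n \<pi> a)"
    and N: "complex_vector.subspace N" "\<not> M \<subseteq> N"
  obtains x where "x \<in> M" "x \<notin> N"
    "\<And>p q. \<lbrakk>p \<in> {1..n}; a p \<noteq> 0; x p \<noteq> 0; q \<in> {1..n}; a q \<noteq> 0; x q \<noteq> 0\<rbrakk> \<Longrightarrow> p = q"
proof -
  obtain B B' where B: "natural_basis (E_perm n \<pi> a\<lparr>calg_carrier := M\<rparr>) B" "B \<subseteq> B'"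
    "natural_basis (E_perm n \<pi> a) B'"
    using P M unfolding condition_P_def by blast
  have span: "complex_vector.span B = M" using B(1) by (simp add: natural_basis_def)
  then have "\<not> B \<subseteq> N" using N complex_vector.span_minimal by metis
  then obtain x where "x \<in> B" "x \<notin> N" by blast
  moreover have "x \<in> M" using \<open>x \<in> B\<close> span complex_vector.span_base by metis
  ultimately show ?thesis
    using that natural_basis_elem_support[OF \<pi> B(3)] B(2) by blast
qed

text \<open>
  The line through the idempotent \<open>u\<close> is a subalgebra all of whose nonzero elements have the support of
  \<open>u\<close>.
\<close>

lemma condition_P_idempotent:
  assumes \<pi>: "\<pi> permutes {1..n}" and P: "condition_P (E_perm n \<pi> a)"
    and u: "u \<in> calg_carrier (E_perm n \<pi> a)" "\<And>i. i \<in> {1..n} \<Longrightarrow> a i * u i ^ 2 = u (\<pi> i)"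
    and p: "p \<in> {1..n}" "a p \<noteq> 0" "u p \<noteq> 0" and q: "q \<in> {1..n}" "a q \<noteq> 0" "u q \<noteq> 0"
  shows "p = q"
proof -
  define M where "M = range (\<lambda>c. c *\<^sub>C u)"
  have mult: "calg_mult (E_perm n \<pi> a) (c *\<^sub>C u) (d *\<^sub>C u) = (c * d) *\<^sub>C u" for c d
  proof (rule E_perm_mult_eqI[OF \<pi>])
    show "(c * d) *\<^sub>C u \<in> calg_carrier (E_perm n \<pi> a)"
      using u(1) by (simp add: E_perm_carrier scaleC_fun_def scaleC_complex_def)
    show "(c *\<^sub>C u) i * (d *\<^sub>C u) i * a i = ((c * d) *\<^sub>C u) (\<pi> i)" if "i \<in> {1..n}" for i
      using u(2)[OF that, symmetric]
      by (simp add: scaleC_fun_def scaleC_complex_def power2_eq_square)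
  qed
  have "complex_vector.subspace M"
    unfolding M_def using complex_vector.subspace_span[of "{u}"]
    by (simp add: complex_vector.span_singleton)
  moreover have "M \<subseteq> calg_carrier (E_perm n \<pi> a)"
    using u(1) by (auto simp: M_def E_perm_carrier scaleC_fun_def scaleC_complex_def)
  moreover have "\<forall>x\<in>M. \<forall>y\<in>M. calg_mult (E_perm n \<pi> a) x y \<in> M"
    by (auto simp: M_def mult)
  ultimately have M: "subalgebra M (E_perm n \<pi> a)"
    unfolding subalgebra_def by blast
  have "u \<in> M" unfolding M_def by (metis rangeI scaleC_one)
  then have "\<not> M \<subseteq> {0}" using p(3) by auto
  then obtain x where x: "x \<in> M" "x \<notin> {0}" and
    supp: "\<And>p q. \<lbrakk>p \<in> {1..n}; a p \<noteq> 0; x p \<noteq> 0; q \<in> {1..n}; a q \<noteq> 0; x q \<noteq> 0\<rbrakk> \<Longrightarrow> p = q"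
    using condition_P_small_support[OF \<pi> P M complex_vector.subspace_single_0] by blast
  then obtain c where c: "x = c *\<^sub>C u" "c \<noteq> 0"
    by (auto simp: M_def)
  show ?thesis
    using supp[OF p(1,2) _ q(1,2)] p(3) q(3) c by (simp add: scaleC_fun_def scaleC_complex_def)
qed

text \<open>
  With \<open>u = unit_fun p + unit_fun q\<close>, the square \<open>w\<close> of \<open>u\<close> is supported at \<open>\<pi> p\<close> and \<open>\<pi> q\<close>, where \<open>a\<close>
  vanishes, so \<open>w\<close> annihilates everything and \<open>u\<close>, \<open>w\<close> span a subalgebra. Any of its elements outside the
  line of \<open>w\<close> has the same nonzero value at \<open>p\<close> and at \<open>q\<close>.
\<close>

lemma condition_P_unique_last_arrow:
  assumes \<pi>: "\<pi> permutes {1..n}" and P: "condition_P (E_perm n \<pi> a)"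
    and p: "p \<in> {1..n}" "a p \<noteq> 0" "a (\<pi> p) = 0" and q: "q \<in> {1..n}" "a q \<noteq> 0" "a (\<pi> q) = 0"
  shows "p = q"
proof (rule ccontr)
  assume "p \<noteq> q"
  define u where "u = unit_fun p + unit_fun q"
  define w where "w = a p *\<^sub>C unit_fun (\<pi> p) + a q *\<^sub>C unit_fun (\<pi> q)"
  define M where "M = {\<alpha> *\<^sub>C u + \<beta> *\<^sub>C w | \<alpha> \<beta>. True}"
  note pointwise = scaleC_fun_def scaleC_complex_def
  have \<pi>in: "\<pi> p \<in> {1..n}" "\<pi> q \<in> {1..n}" using permutes_in_image[OF \<pi>] p q by blast+
  have carrier: "u \<in> calg_carrier (E_perm n \<pi> a)" "w \<in> calg_carrier (E_perm n \<pi> a)"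
    using p(1) q(1) \<pi>in by (auto simp: E_perm_carrier u_def w_def unit_fun_def pointwise)
  have ne: "p \<noteq> \<pi> p" "p \<noteq> \<pi> q" "q \<noteq> \<pi> p" "q \<noteq> \<pi> q" using p q by metis+
  have \<pi>eq: "\<pi> i = \<pi> j \<longleftrightarrow> i = j" for i j using permutes_inj[OF \<pi>] by (simp add: inj_eq)
  have mult: "calg_mult (E_perm n \<pi> a) (\<alpha> *\<^sub>C u + \<beta> *\<^sub>C w) (\<gamma> *\<^sub>C u + \<delta> *\<^sub>C w) = (\<alpha> * \<gamma>) *\<^sub>C w"
    for \<alpha> \<beta> \<gamma> \<delta>
  proof (rule E_perm_mult_eqI[OF \<pi>])
    show "(\<alpha> * \<gamma>) *\<^sub>C w \<in> calg_carrier (E_perm n \<pi> a)"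
      using carrier(2) by (simp add: E_perm_carrier pointwise)
    have w0: "w i * a i = 0" for i
      using p q by (auto simp: w_def unit_fun_def pointwise)
    have "(\<alpha> *\<^sub>C u + \<beta> *\<^sub>C w) i * (\<gamma> *\<^sub>C u + \<delta> *\<^sub>C w) i * a i =
        \<alpha> * \<gamma> * (u i ^ 2 * a i) + (\<alpha> * \<delta> * u i + \<beta> * \<gamma> * u i + \<beta> * \<delta> * w i) * (w i * a i)" for i
      by (simp add: pointwise algebra_simps power2_eq_square)
    moreover have "u i ^ 2 * a i = w (\<pi> i)" for i
      using \<open>p \<noteq> q\<close> by (auto simp: u_def w_def unit_fun_def pointwise \<pi>eq)
    ultimately show "(\<alpha> *\<^sub>C u + \<beta> *\<^sub>C w) i * (\<gamma> *\<^sub>C u + \<delta> *\<^sub>C w) i * a i = ((\<alpha> * \<gamma>) *\<^sub>C w) (\<pi> i)" for i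
      using w0 by (simp add: pointwise)
  qed
  have M_span: "M = complex_vector.span {u, w}"
    unfolding M_def
    by (auto simp: complex_vector.span_insert complex_vector.span_singleton diff_eq_eq) (metis add.commute)+
  have "complex_vector.subspace M"
    unfolding M_span by (rule complex_vector.subspace_span)
  moreover have "calg_mult (E_perm n \<pi> a) x y \<in> M" if x: "x \<in> M" and y: "y \<in> M" for x y
  proof -
    obtain \<alpha> \<beta> where "x = \<alpha> *\<^sub>C u + \<beta> *\<^sub>C w" using x by (auto simp: M_def)
    moreover obtain \<gamma> \<delta> where "y = \<gamma> *\<^sub>C u + \<delta> *\<^sub>C w" using y by (auto simp: M_def)
    ultimately have "calg_mult (E_perm n \<pi> a) x y = 0 *\<^sub>C u + (\<alpha> * \<gamma>) *\<^sub>C w" using mult by simp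
    then show ?thesis unfolding M_def by blast
  qed
  moreover have "M \<subseteq> calg_carrier (E_perm n \<pi> a)"
    using carrier by (auto simp: M_def E_perm_carrier pointwise)
  ultimately have M: "subalgebra M (E_perm n \<pi> a)"
    unfolding subalgebra_def by blast
  have "u \<notin> complex_vector.span {w}"
  proof
    assume "u \<in> complex_vector.span {w}"
    then obtain c where "u = c *\<^sub>C w" by (auto simp: complex_vector.span_singleton)
    then have "u p = c * w p" by (simp add: pointwise)
    then show False using ne \<open>p \<noteq> q\<close> by (simp add: u_def w_def unit_fun_def pointwise)
  qed
  moreover have "u \<in> M" unfolding M_span by (simp add: complex_vector.span_base)
  ultimately have "\<not> M \<subseteq> complex_vector.span {w}" by blast
  then obtain x where x: "x \<in> M" "x \<notin> complex_vector.span {w}" and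
    supp: "\<And>p q. \<lbrakk>p \<in> {1..n}; a p \<noteq> 0; x p \<noteq> 0; q \<in> {1..n}; a q \<noteq> 0; x q \<noteq> 0\<rbrakk> \<Longrightarrow> p = q"
    using condition_P_small_support[OF \<pi> P M complex_vector.subspace_span] by blast
  obtain \<alpha> \<beta> where \<alpha>: "x = \<alpha> *\<^sub>C u + \<beta> *\<^sub>C w" using x(1) by (auto simp: M_def)
  have "\<alpha> \<noteq> 0" using x(2) \<alpha> complex_vector.span_scale[OF complex_vector.span_base[of w "{w}"]] by auto
  moreover have "x p = \<alpha>" "x q = \<alpha>"
    using \<alpha> ne \<open>p \<noteq> q\<close> by (auto simp: u_def w_def unit_fun_def pointwise)
  ultimately show False using supp[of p q] p q \<open>p \<noteq> q\<close> by simp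
qed

text \<open>
  Starting from \<open>w 0 = z\<close>, the recursion gives \<open>w j = A j * z ^ 2 ^ j\<close> with nonzero constants \<open>A j\<close>. The
  orbit closes up after \<open>N > 0\<close> steps when \<open>A N * z ^ (2 ^ N - 1) = 1\<close>, which has a complex solution.
\<close>

lemma quadratic_cycle_solution:
  fixes c :: "nat \<Rightarrow> complex"
  assumes "0 < N" "\<And>j. c j \<noteq> 0"
  obtains w where "\<And>j. w (Suc j) = c j * w j ^ 2" "\<And>j. w j \<noteq> 0" "w N = w 0"
proof -
  define A where "A = rec_nat 1 (\<lambda>j x. c j * x ^ 2)"
  have A_Suc: "A (Suc j) = c j * A j ^ 2" and A_0: "A 0 = 1" for j by (simp_all add: A_def)
  have A_nz: "A j \<noteq> 0" for j by (induction j) (simp_all add: A_0 A_Suc assms(2))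
  have "(2::nat) ^ N > 1" using assms(1) by (intro one_less_power) simp_all
  then have e: "(2::nat) ^ N - 1 \<noteq> 0" by simp
  obtain z where z: "z \<noteq> 0" "1 / A N = z ^ (2 ^ N - 1)"
    using exists_complex_root_nonzero[of "1 / A N" "2 ^ N - 1"] e A_nz by (metis divide_eq_0_iff zero_neq_one)
  define w where "w j = A j * z ^ 2 ^ j" for j
  have "A N * z ^ (2 ^ N - 1) = 1"
    using z(2) A_nz[of N] by (simp add: field_simps)
  moreover have "z ^ 2 ^ N = z ^ (2 ^ N - 1) * z"
    using power_minus_mult[of "2 ^ N" z] by simp
  ultimately have "w N = w 0"
    by (simp add: w_def A_0 flip: mult.assoc)
  moreover have "w (Suc j) = c j * w j ^ 2" for j
    by (simp add: w_def A_Suc power_mult_distrib power_mult[symmetric] mult.commute)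
  moreover have "w j \<noteq> 0" for j using A_nz z(1) by (simp add: w_def)
  ultimately show ?thesis using that by blast
qed

text \<open>
  The equation on \<open>u\<close> says that it is an idempotent. As \<open>\<pi>\<close> is a permutation, \<open>p\<close> lies on a cycle, of
  length \<open>N\<close> say, and the values of \<open>u\<close> along the cycle are a solution of the cyclic system of quadratic
  equations.
\<close>

lemma cycle_idempotent:
  fixes a :: "nat \<Rightarrow> complex"
  assumes \<pi>: "\<pi> permutes {1..n}" and p: "p \<in> {1..n}" and nz: "\<forall>k. a ((\<pi> ^^ k) p) \<noteq> 0"
  obtains u where "u \<in> calg_carrier (E_perm n \<pi> a)"
    "\<And>i. i \<in> {1..n} \<Longrightarrow> a i * u i ^ 2 = u (\<pi> i)" "\<And>k. u ((\<pi> ^^ k) p) \<noteq> 0"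
proof -
  have inj: "inj (\<pi> ^^ k)" for k using permutes_inj[OF \<pi>] by (rule inj_fn)
  define N where "N = (LEAST N. 0 < N \<and> (\<pi> ^^ N) p = p)"
  have "\<exists>N. 0 < N \<and> (\<pi> ^^ N) p = p"
    using permutation_self[OF permutes_imp_permutation[OF _ \<pi>]] by (metis finite_atLeastAtMost)
  then have N: "0 < N" "(\<pi> ^^ N) p = p"
    using LeastI_ex[of "\<lambda>N. 0 < N \<and> (\<pi> ^^ N) p = p"] by (simp_all add: N_def)
  have least: "N \<le> m" if "0 < m" "(\<pi> ^^ m) p = p" for m
    using that unfolding N_def by (intro Least_le) simp
  obtain w where w: "\<And>j. w (Suc j) = a ((\<pi> ^^ j) p) * w j ^ 2" "\<And>j. w j \<noteq> 0" "w N = w 0"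
    using quadratic_cycle_solution[OF N(1), of "\<lambda>j. a ((\<pi> ^^ j) p)"] nz by blast
  have w_period: "w (j + N) = w j" for j
    by (induction j) (simp_all add: w N(2) funpow_add)
  have w_period_mult: "w (j + N * l) = w j" for j l
    by (induction l) (simp_all add: w_period add.assoc[symmetric] add.commute[of N])
  \<comment> \<open>Equal points of the orbit have times that agree modulo the period, so \<open>w\<close> descends to the orbit.\<close>
  have le: "w i = w j" if eq: "(\<pi> ^^ i) p = (\<pi> ^^ j) p" and ij: "i \<le> j" for i j
  proof -
    have "(\<pi> ^^ i) p = (\<pi> ^^ i) ((\<pi> ^^ (j - i)) p)"
      using eq ij by (metis comp_apply funpow_add le_add_diff_inverse)
    then have "(\<pi> ^^ (j - i)) p = p" using inj by (metis injD)
    then have "(\<pi> ^^ ((j - i) mod N)) p = p" using funpow_mod_eq[OF N(2)] by metis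
    then have "(j - i) mod N = 0" using least[of "(j - i) mod N"] N(1)
      by (metis linorder_not_less mod_less_divisor neq0_conv)
    then obtain l where "j = i + N * l" using ij by (metis dvdE le_add_diff_inverse mod_0_imp_dvd)
    then show ?thesis using w_period_mult by simp
  qed
  then have w_eq: "w i = w j" if "(\<pi> ^^ i) p = (\<pi> ^^ j) p" for i j
    using that by (metis nle_le)
  define u where "u i = (if \<exists>j. i = (\<pi> ^^ j) p then w (SOME j. i = (\<pi> ^^ j) p) else 0)" for i
  have u: "u ((\<pi> ^^ j) p) = w j" for j
  proof -
    have "(\<pi> ^^ j) p = (\<pi> ^^ (SOME i. (\<pi> ^^ j) p = (\<pi> ^^ i) p)) p" by (rule someI) (rule refl)
    then have "w j = w (SOME i. (\<pi> ^^ j) p = (\<pi> ^^ i) p)" by (rule w_eq)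
    then show ?thesis unfolding u_def by (metis (mono_tags))
  qed
  have "a i * u i ^ 2 = u (\<pi> i)" for i
  proof (cases "\<exists>j. i = (\<pi> ^^ j) p")
    case True
    then obtain j where j: "i = (\<pi> ^^ j) p" by blast
    then have "\<pi> i = (\<pi> ^^ Suc j) p" by simp
    then show ?thesis using u j w(1) by metis
  next
    case False
    have "\<pi> i \<noteq> (\<pi> ^^ j) p" for j
    proof
      assume "\<pi> i = (\<pi> ^^ j) p"
      then have "\<pi> i = (\<pi> ^^ (j + N)) p" using N(2) by (simp add: funpow_add)
      also have "\<dots> = \<pi> ((\<pi> ^^ (j + N - 1)) p)"
        using N(1) by (metis Suc_diff_1 add_gr_0 comp_apply funpow.simps(2))
      finally show False using False permutes_inj[OF \<pi>] by (metis injD)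
    qed
    then show ?thesis using False by (simp add: u_def)
  qed
  moreover have "u \<in> calg_carrier (E_perm n \<pi> a)"
    using permutes_in_funpow_image[OF \<pi> p] by (auto simp: E_perm_carrier u_def)
  ultimately show ?thesis using that[of u] u w(2) by simp
qed

text \<open>
  Both \<open>p\<close> and \<open>\<pi> p\<close> lie in the support of the idempotent of the cycle through \<open>p\<close>.
\<close>

lemma condition_P_cyclic_index:
  assumes \<pi>: "\<pi> permutes {1..n}" and P: "condition_P (E_perm n \<pi> a)"
    and p: "p \<in> {1..n}" "\<forall>k. a ((\<pi> ^^ k) p) \<noteq> 0"
  shows "\<pi> p = p"
proof -
  obtain u where u: "u \<in> calg_carrier (E_perm n \<pi> a)"
    "\<And>i. i \<in> {1..n} \<Longrightarrow> a i * u i ^ 2 = u (\<pi> i)" "\<And>k. u ((\<pi> ^^ k) p) \<noteq> 0"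
    using cycle_idempotent[OF \<pi> p] by blast
  have "\<pi> p \<in> {1..n}" using p(1) permutes_in_image[OF \<pi>] by blast
  then show ?thesis
    using condition_P_idempotent[OF \<pi> P u(1,2), of "\<pi> p" p] p(1) p(2)[rule_format, of 0] p(2)[rule_format, of 1] u(3)[of 0] u(3)[of 1]
    by simp
qed

text \<open>
  Both indices are loops, and \<open>1 / a i\<close> times the basis vector is the idempotent of a loop at \<open>i\<close>. The
  idempotents of distinct loops annihilate each other, so their sum is idempotent as well.
\<close>

lemma condition_P_unique_cyclic_index:
  assumes \<pi>: "\<pi> permutes {1..n}" and P: "condition_P (E_perm n \<pi> a)"
    and p: "p \<in> {1..n}" "\<forall>k. a ((\<pi> ^^ k) p) \<noteq> 0"
    and q: "q \<in> {1..n}" "\<forall>k. a ((\<pi> ^^ k) q) \<noteq> 0"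
  shows "p = q"
proof (rule condition_P_idempotent[OF \<pi> P])
  define u where "u i = (if i = p \<or> i = q then 1 / a i else 0)" for i
  note fixed = condition_P_cyclic_index[OF \<pi> P p] condition_P_cyclic_index[OF \<pi> P q]
  have nz: "a p \<noteq> 0" "a q \<noteq> 0" using p(2)[rule_format, of 0] q(2)[rule_format, of 0] by auto
  show "u \<in> calg_carrier (E_perm n \<pi> a)" using p q by (auto simp: u_def E_perm_carrier)
  show "a i * u i ^ 2 = u (\<pi> i)" for i
  proof -
    have "\<pi> i = p \<longleftrightarrow> i = p" "\<pi> i = q \<longleftrightarrow> i = q"
      using fixed permutes_inj[OF \<pi>] by (metis injD)+
    then show ?thesis using fixed nz by (auto simp: u_def power2_eq_square)
  qed
  show "u p \<noteq> 0" "u q \<noteq> 0" "a p \<noteq> 0" "a q \<noteq> 0" using nz by (simp_all add: u_def)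
qed (use p q in auto)

section \<open>The chain of non-cyclic indices\<close>

text \<open>
  From any index in question the arrows lead after \<open>K i\<close> steps to a zero of \<open>a\<close>, and the arrow just
  before is the unique last one. Hence all these paths end at the same point, and by injectivity of
  \<open>\<pi>\<close> each of them is a final segment of the longest one, whose start is \<open>p\<close>.
\<close>

lemma unique_last_arrow_chain:
  fixes a :: "nat \<Rightarrow> complex"
  assumes \<pi>: "\<pi> permutes {1..n}"
    and last: "\<And>p q. \<lbrakk>p \<in> {1..n}; a p \<noteq> 0; a (\<pi> p) = 0; q \<in> {1..n}; a q \<noteq> 0; a (\<pi> q) = 0\<rbrakk> \<Longrightarrow> p = q"
    and ex: "i\<^sub>0 \<in> {1..n}" "a i\<^sub>0 \<noteq> 0" "a ((\<pi> ^^ k\<^sub>0) i\<^sub>0) = 0"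
  obtains p s where "p \<in> {1..n}" "1 \<le> s" "\<And>j. j < s \<Longrightarrow> a ((\<pi> ^^ j) p) \<noteq> 0" "a ((\<pi> ^^ s) p) = 0"
    "\<And>i k. \<lbrakk>i \<in> {1..n}; a i \<noteq> 0; a ((\<pi> ^^ k) i) = 0\<rbrakk> \<Longrightarrow> \<exists>j<s. i = (\<pi> ^^ j) p"
proof -
  have inj: "inj (\<pi> ^^ k)" for k using permutes_inj[OF \<pi>] by (rule inj_fn)
  note orbit = permutes_in_funpow_image[OF \<pi>]
  define T where "T = {i \<in> {1..n}. a i \<noteq> 0 \<and> (\<exists>k. a ((\<pi> ^^ k) i) = 0)}"
  define K where "K i = (LEAST k. a ((\<pi> ^^ k) i) = 0)" for i
  have K0: "a ((\<pi> ^^ K i) i) = 0" if "i \<in> T" for i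
    using that unfolding T_def K_def by (auto intro: LeastI_ex)
  have K_nz: "a ((\<pi> ^^ j) i) \<noteq> 0" if "j < K i" for i j
    using that unfolding K_def by (rule not_less_Least)
  have K_pos: "0 < K i" if "i \<in> T" for i
    using K0[OF that] that by (cases "K i") (auto simp: T_def)
  have end_eq: "(\<pi> ^^ K i) i = (\<pi> ^^ K i') i'" if i: "i \<in> T" and i': "i' \<in> T" for i i'
  proof -
    have step: "(\<pi> ^^ K i) i = \<pi> ((\<pi> ^^ (K i - 1)) i)" if "i \<in> T" for i
      using K_pos[OF that] by (metis Suc_diff_1 comp_apply funpow.simps(2))
    have "(\<pi> ^^ (K i - 1)) i = (\<pi> ^^ (K i' - 1)) i'"
    proof (rule last)
      show "(\<pi> ^^ (K i - 1)) i \<in> {1..n}" "(\<pi> ^^ (K i' - 1)) i' \<in> {1..n}"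
        using orbit i i' by (simp_all add: T_def del: atLeastAtMost_iff)
      show "a ((\<pi> ^^ (K i - 1)) i) \<noteq> 0" "a ((\<pi> ^^ (K i' - 1)) i') \<noteq> 0"
        using K_nz K_pos i i' by simp_all
      show "a (\<pi> ((\<pi> ^^ (K i - 1)) i)) = 0" "a (\<pi> ((\<pi> ^^ (K i' - 1)) i')) = 0"
        using K0 step i i' by metis+
    qed
    then show ?thesis using step i i' by simp
  qed
  have "finite (K ` T)" by (simp add: T_def)
  moreover have "K ` T \<noteq> {}" using ex by (auto simp: T_def)
  ultimately have "Max (K ` T) \<in> K ` T" "\<And>i. i \<in> T \<Longrightarrow> K i \<le> Max (K ` T)"
    by simp_all
  then obtain p where p: "p \<in> T" "\<And>i. i \<in> T \<Longrightarrow> K i \<le> K p"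
    by (metis imageE)
  have "\<exists>j<K p. i = (\<pi> ^^ j) p" if "i \<in> T" for i
  proof -
    have "(\<pi> ^^ K i) i = (\<pi> ^^ K p) p" using end_eq that p(1) by blast
    also have "\<dots> = (\<pi> ^^ K i) ((\<pi> ^^ (K p - K i)) p)"
      using p(2)[OF that] by (metis comp_apply funpow_add le_add_diff_inverse)
    finally have "i = (\<pi> ^^ (K p - K i)) p" using inj by (metis injD)
    moreover have "K p - K i < K p" using K_pos[OF that] p(2)[OF that] by simp
    ultimately show ?thesis by blast
  qed
  then show ?thesis
    using that[of p "K p"] p(1) K_pos[OF p(1)] K0[OF p(1)] K_nz by (auto simp: T_def)
qed

section \<open>Recognising the normal forms\<close>

lemma ES1_Czero_splitting:
  assumes "1 \<le> n"
  shows "evol_alg n (\<lambda>i. if i = 1 then unit_fun 1 else 0) \<cong>\<^sub>A ES1 \<oplus>\<^sub>A Czero (n - 1)"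
proof -
  have "evol_alg (1 + (n - 1)) (\<lambda>i. if i \<le> 1 then unit_fun 1 else shift 1 0) \<cong>\<^sub>A ES1 \<oplus>\<^sub>A Czero (n - 1)"
    using evol_alg_split[of 1 "\<lambda>i. unit_fun 1" "n - 1" "\<lambda>i. 0"]
    unfolding ES1_def Czero_def by (auto simp: evol_alg_carrier unit_fun_def)
  moreover have "evol_alg (1 + (n - 1)) (\<lambda>i. if i \<le> 1 then unit_fun 1 else shift 1 0) =
      evol_alg n (\<lambda>i. if i = 1 then unit_fun 1 else 0)"
    using assms by (auto simp: evol_alg_def shift_def fun_eq_iff sum_fun_apply scaleC_fun_def
        intro!: sum.cong)
  ultimately show ?thesis by simp
qed

lemma EN_Czero_splitting:
  assumes "s \<le> n"
  shows "evol_alg n (\<lambda>i. if i < s then unit_fun (i + 1) else 0) \<cong>\<^sub>A EN s \<oplus>\<^sub>A Czero (n - s)"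
proof -
  let ?q = "\<lambda>i. if i < s then unit_fun (i + 1) else 0"
  have "evol_alg (s + (n - s)) (\<lambda>i. if i \<le> s then ?q i else shift s 0) \<cong>\<^sub>A EN s \<oplus>\<^sub>A Czero (n - s)"
    unfolding EN_def Czero_def
    by (rule evol_alg_split) (auto simp: evol_alg_carrier unit_fun_def)
  moreover have "(\<lambda>i. if i \<le> s then ?q i else shift s 0) = ?q"
    by (auto simp: shift_def fun_eq_iff)
  ultimately show ?thesis using assms by simp
qed

lemma ES1_EN_Czero_splitting:
  assumes "s + 1 \<le> n"
  shows "evol_alg n (\<lambda>i. if i \<le> 1 then unit_fun 1 else if i < s + 1 then unit_fun (i + 1) else 0)
           \<cong>\<^sub>A ES1 \<oplus>\<^sub>A EN s \<oplus>\<^sub>A Czero (n - s - 1)"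
proof -
  let ?r = "\<lambda>i. if i < s then unit_fun (i + 1) else 0"
  have "evol_alg (1 + (n - 1)) (\<lambda>i. if i \<le> 1 then unit_fun 1 else shift 1 (?r (i - 1)))
      \<cong>\<^sub>A ES1 \<oplus>\<^sub>A evol_alg (n - 1) ?r"
    unfolding ES1_def using assms
    by (intro evol_alg_split) (auto simp: evol_alg_carrier unit_fun_def)
  moreover have "(\<lambda>i. if i \<le> 1 then unit_fun 1 else shift 1 (?r (i - 1))) =
      (\<lambda>i. if i \<le> 1 then unit_fun 1 else if i < s + 1 then unit_fun (i + 1) else 0)"
    by (auto simp: shift_def fun_eq_iff unit_fun_def)
  moreover have "ES1 \<oplus>\<^sub>A evol_alg (n - 1) ?r \<cong>\<^sub>A ES1 \<oplus>\<^sub>A EN s \<oplus>\<^sub>A Czero (n - 1 - s)"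
    using assms by (intro calg_sum_isomorphic_right EN_Czero_splitting) simp
  moreover have eq: "n - 1 - s = n - s - 1" "1 + (n - 1) = n" using assms by simp_all
  ultimately show ?thesis
    unfolding eq by (auto intro: calg_isomorphic_trans)
qed

text \<open>
  The number of steps still needed to reach the zero of \<open>a\<close> distinguishes the points of the chain.
\<close>

lemma chain_inj_on:
  fixes \<pi> :: "'a \<Rightarrow> 'a" and a :: "'a \<Rightarrow> 'b::zero"
  assumes "\<And>j. j < s \<Longrightarrow> a ((\<pi> ^^ j) p) \<noteq> 0" "a ((\<pi> ^^ s) p) = 0"
  shows "inj_on (\<lambda>j. (\<pi> ^^ j) p) {..s}"
proof (rule linorder_inj_onI)
  fix i j assume ij: "i < j" "i \<in> {..s}" "j \<in> {..s}"
  show "(\<pi> ^^ i) p \<noteq> (\<pi> ^^ j) p"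
  proof
    assume "(\<pi> ^^ i) p = (\<pi> ^^ j) p"
    then have "(\<pi> ^^ (s - j + i)) p = (\<pi> ^^ (s - j + j)) p" by (simp only: funpow_add o_apply)
    moreover have "s - j + i < s" "s - j + j = s" using ij by auto
    ultimately show False using assms by metis
  qed
qed auto

text \<open>
  Along a chain the rescaling is determined by taking each new basis vector to be the square of the
  preceding one.
\<close>

lemma chain_scaling:
  fixes c :: "nat \<Rightarrow> complex"
  assumes "\<And>j. j < s \<Longrightarrow> c j \<noteq> 0"
  obtains d where "\<And>j. d (Suc j) = d j ^ 2 * c j" "\<And>j. j \<le> s \<Longrightarrow> d j \<noteq> 0"
proof -
  define d where "d = rec_nat 1 (\<lambda>j x. x ^ 2 * c j)"
  have "d j \<noteq> 0" if "j \<le> s" for j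
    using that by (induction j) (auto simp: d_def assms)
  then show ?thesis using that[of d] by (simp add: d_def)
qed

lemma E_perm_loop:
  assumes \<pi>: "\<pi> permutes {1..n}" and l: "l \<in> {1..n}" "\<pi> l = l" "a l \<noteq> 0"
    and supp: "\<And>i. i \<in> {1..n} \<Longrightarrow> a i \<noteq> 0 \<Longrightarrow> i = l"
  shows "E_perm n \<pi> a \<cong>\<^sub>A ES1 \<oplus>\<^sub>A Czero (n - 1)"
proof -
  have "E_perm n \<pi> a \<cong>\<^sub>A evol_alg n (\<lambda>i. if i = 1 then unit_fun 1 else 0)"
  proof (rule E_perm_relabel[OF \<pi>, where m = 1 and g = "\<lambda>_. l" and d = "\<lambda>_. 1 / a l"])
    show "i \<in> (\<lambda>_. l) ` {1..1::nat}" if "i \<in> {1..n}" "a i \<noteq> 0" for i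
      using supp[OF that] by (intro image_eqI[of _ _ 1]) simp_all
  qed (use l in \<open>auto simp: power2_eq_square\<close>)
  moreover have "1 \<le> n" using l(1) by simp
  ultimately show ?thesis using calg_isomorphic_trans ES1_Czero_splitting by blast
qed

text \<open>
  The indices of the chain start at \<open>0\<close> and the basis of \<open>EN (s + 1)\<close> at \<open>1\<close>, which accounts for the
  shifts by one. With \<open>s = 0\<close> this covers the algebra with zero multiplication.
\<close>

lemma E_perm_chain:
  fixes a :: "nat \<Rightarrow> complex"
  assumes \<pi>: "\<pi> permutes {1..n}" and p: "p \<in> {1..n}"
    and chain: "\<And>j. j < s \<Longrightarrow> a ((\<pi> ^^ j) p) \<noteq> 0" "a ((\<pi> ^^ s) p) = 0"
    and supp: "\<And>i. i \<in> {1..n} \<Longrightarrow> a i \<noteq> 0 \<Longrightarrow> \<exists>j<s. i = (\<pi> ^^ j) p"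
  shows "s + 1 \<le> n \<and> E_perm n \<pi> a \<cong>\<^sub>A EN (s + 1) \<oplus>\<^sub>A Czero (n - (s + 1))"
proof -
  obtain d where d: "\<And>j. d (Suc j) = d j ^ 2 * a ((\<pi> ^^ j) p)" "\<And>j. j \<le> s \<Longrightarrow> d j \<noteq> 0"
    using chain_scaling[of s "\<lambda>j. a ((\<pi> ^^ j) p)"] chain(1) by blast
  define g where "g i = (\<pi> ^^ (i - 1)) p" for i
  have inj: "inj_on g {1..s + 1}"
    using inj_on_eq_iff[OF chain_inj_on[of s a \<pi> p, OF chain]] by (auto simp: inj_on_def g_def)
  have g: "g ` {1..s + 1} \<subseteq> {1..n}"
    using permutes_in_funpow_image[OF \<pi> p] by (auto simp: g_def simp del: atLeastAtMost_iff)
  have s: "s + 1 \<le> n"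
    using card_inj_on_le[OF inj g] by simp
  have "E_perm n \<pi> a \<cong>\<^sub>A evol_alg n (\<lambda>i. if i < s + 1 then unit_fun (i + 1) else 0)"
  proof (rule E_perm_relabel[OF \<pi> s inj g, where d = "\<lambda>i. d (i - 1)"])
    show "i \<in> g ` {1..s + 1}" if i: "i \<in> {1..n}" "a i \<noteq> 0" for i
    proof -
      obtain j where "j < s" "i = (\<pi> ^^ j) p" using supp[OF i] by blast
      then show ?thesis by (intro image_eqI[of _ _ "j + 1"]) (auto simp: g_def)
    qed
    fix i assume i: "i \<in> {1..s + 1}"
    then obtain j where j: "i = Suc j" by (cases i) auto
    show "a (g i) = 0 \<and> (if i < s + 1 then unit_fun (i + 1) else 0) = 0 \<or>
      (\<exists>t\<in>{1..s + 1}. (if i < s + 1 then unit_fun (i + 1) else 0) = unit_fun t \<and>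
        \<pi> (g i) = g t \<and> d (i - 1) ^ 2 * a (g i) = d (t - 1))"
    proof (cases "i < s + 1")
      case True
      then show ?thesis using j d(1)
        by (intro disjI2 bexI[of _ "i + 1"]) (auto simp: g_def)
    next
      case False
      then show ?thesis using i j chain(2) by (auto simp: g_def)
    qed
  qed (use d(2) in auto)
  then show ?thesis using s calg_isomorphic_trans EN_Czero_splitting by blast
qed

text \<open>
  The loop takes position \<open>1\<close> and the chain the positions \<open>2\<close> to \<open>s + 2\<close>. The loop is disjoint from the
  chain because every point of the chain is led by \<open>\<pi>\<close> to a zero of \<open>a\<close>.
\<close>

lemma E_perm_loop_chain:
  fixes a :: "nat \<Rightarrow> complex"
  assumes \<pi>: "\<pi> permutes {1..n}" and p: "p \<in> {1..n}"
    and l: "l \<in> {1..n}" "\<pi> l = l" "a l \<noteq> 0"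
    and chain: "\<And>j. j < s \<Longrightarrow> a ((\<pi> ^^ j) p) \<noteq> 0" "a ((\<pi> ^^ s) p) = 0"
    and supp: "\<And>i. i \<in> {1..n} \<Longrightarrow> a i \<noteq> 0 \<Longrightarrow> i = l \<or> (\<exists>j<s. i = (\<pi> ^^ j) p)"
  shows "s + 2 \<le> n \<and> E_perm n \<pi> a \<cong>\<^sub>A ES1 \<oplus>\<^sub>A EN (s + 1) \<oplus>\<^sub>A Czero (n - (s + 1) - 1)"
proof -
  obtain d where d: "\<And>j. d (Suc j) = d j ^ 2 * a ((\<pi> ^^ j) p)" "\<And>j. j \<le> s \<Longrightarrow> d j \<noteq> 0"
    using chain_scaling[of s "\<lambda>j. a ((\<pi> ^^ j) p)"] chain(1) by blast
  define g where "g i = (if i \<le> 1 then l else (\<pi> ^^ (i - 2)) p)" for i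
  have loop: "(\<pi> ^^ k) l = l" for k using l(2) by (induction k) auto
  have off_chain: "(\<pi> ^^ j) p \<noteq> l" if "j \<le> s" for j
  proof
    assume "(\<pi> ^^ j) p = l"
    then have "(\<pi> ^^ (s - j + j)) p = l" using loop by (simp add: funpow_add)
    then show False using that chain(2) l(3) by simp
  qed
  have inj: "inj_on g {1..s + 2}"
  proof (rule linorder_inj_onI)
    fix i j assume ij: "i < j" "i \<in> {1..s + 2}" "j \<in> {1..s + 2}"
    show "g i \<noteq> g j"
    proof (cases "i = 1")
      case True
      moreover have "j - 2 \<le> s" using ij(3) by (simp del: One_nat_def) linarith
      ultimately show ?thesis using off_chain[of "j - 2"] ij by (auto simp: g_def)
    next
      case False
      then have "i - 2 \<noteq> j - 2" "i - 2 \<in> {..s}" "j - 2 \<in> {..s}" using ij by auto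
      then have "(\<pi> ^^ (i - 2)) p \<noteq> (\<pi> ^^ (j - 2)) p"
        using chain_inj_on[of s a \<pi> p, OF chain] by (meson inj_on_eq_iff)
      then show ?thesis using False ij by (simp add: g_def)
    qed
  qed auto
  have g: "g ` {1..s + 2} \<subseteq> {1..n}"
    using permutes_in_funpow_image[OF \<pi> p] l(1) by (auto simp: g_def simp del: atLeastAtMost_iff)
  have s: "s + 2 \<le> n"
    using card_inj_on_le[OF inj g] by simp
  let ?q = "\<lambda>i. if i \<le> 1 then unit_fun 1 else if i < s + 1 + 1 then unit_fun (i + 1) else 0"
  let ?d = "\<lambda>i. if i \<le> 1 then 1 / a l else d (i - 2)"
  have "E_perm n \<pi> a \<cong>\<^sub>A evol_alg n ?q"
  proof (rule E_perm_relabel[OF \<pi> s inj g, where d = ?d])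
    show "i \<in> g ` {1..s + 2}" if i: "i \<in> {1..n}" "a i \<noteq> 0" for i
      using supp[OF i]
    proof
      assume "i = l"
      then show ?thesis by (intro image_eqI[of _ _ 1]) (auto simp: g_def)
    next
      assume "\<exists>j<s. i = (\<pi> ^^ j) p"
      then obtain j where "j < s" "i = (\<pi> ^^ j) p" by blast
      then show ?thesis by (intro image_eqI[of _ _ "j + 2"]) (auto simp: g_def)
    qed
    fix i assume i: "i \<in> {1..s + 2}"
    show "a (g i) = 0 \<and> ?q i = 0 \<or>
      (\<exists>t\<in>{1..s + 2}. ?q i = unit_fun t \<and> \<pi> (g i) = g t \<and> ?d i ^ 2 * a (g i) = ?d t)"
    proof (cases "i = 1")
      case True
      then show ?thesis using l
        by (intro disjI2 bexI[of _ 1]) (auto simp: g_def power2_eq_square)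
    next
      case False
      then obtain j where j: "i = Suc (Suc j)" using i by (cases i; cases "i - 1") auto
      show ?thesis
      proof (cases "i < s + 2")
        case True
        then show ?thesis using j d(1)
          by (intro disjI2 bexI[of _ "i + 1"]) (auto simp: g_def)
      next
        case False
        then show ?thesis using i j chain(2) by (auto simp: g_def)
      qed
    qed
  qed (use d(2) l in auto)
  moreover have "evol_alg n ?q \<cong>\<^sub>A ES1 \<oplus>\<^sub>A EN (s + 1) \<oplus>\<^sub>A Czero (n - (s + 1) - 1)"
    using s by (intro ES1_EN_Czero_splitting) simp
  ultimately show ?thesis using s calg_isomorphic_trans by blast
qed

lemma condition_P_classification:
  assumes n: "1 \<le> n" and \<pi>: "\<pi> permutes {1..n}" and P: "condition_P (E_perm n \<pi> a)"
  shows "E_perm n \<pi> a \<cong>\<^sub>A ES1 \<oplus>\<^sub>A Czero (n - 1) \<or>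
    (\<exists>s\<in>{1..n}. E_perm n \<pi> a \<cong>\<^sub>A EN s \<oplus>\<^sub>A Czero (n - s)) \<or>
    (\<exists>s\<in>{2..n-1}. E_perm n \<pi> a \<cong>\<^sub>A ES1 \<oplus>\<^sub>A EN s \<oplus>\<^sub>A Czero (n - s - 1))"
proof -
  define C where "C = {i \<in> {1..n}. \<forall>k. a ((\<pi> ^^ k) i) \<noteq> 0}"
  have C_loop: "l \<in> {1..n}" "\<pi> l = l" "a l \<noteq> 0" if "l \<in> C" for l
    using that condition_P_cyclic_index[OF \<pi> P] by (auto simp: C_def dest: spec[of _ 0])
  have C_unique: "i = l" if "i \<in> C" "l \<in> C" for i l
    using that condition_P_unique_cyclic_index[OF \<pi> P] by (auto simp: C_def)
  show ?thesis
  proof (cases "\<exists>i\<in>{1..n}. a i \<noteq> 0 \<and> i \<notin> C")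
    case True
    then obtain i\<^sub>0 k\<^sub>0 where "i\<^sub>0 \<in> {1..n}" "a i\<^sub>0 \<noteq> 0" "a ((\<pi> ^^ k\<^sub>0) i\<^sub>0) = 0"
      by (auto simp: C_def)
    then obtain p s where p: "p \<in> {1..n}" and s: "1 \<le> s"
      and chain: "\<And>j. j < s \<Longrightarrow> a ((\<pi> ^^ j) p) \<noteq> 0" "a ((\<pi> ^^ s) p) = 0"
      and all: "\<And>i k. \<lbrakk>i \<in> {1..n}; a i \<noteq> 0; a ((\<pi> ^^ k) i) = 0\<rbrakk> \<Longrightarrow> \<exists>j<s. i = (\<pi> ^^ j) p"
      using unique_last_arrow_chain[OF \<pi>, of a i\<^sub>0 k\<^sub>0] condition_P_unique_last_arrow[OF \<pi> P] by blast
    have supp: "i \<in> C \<or> (\<exists>j<s. i = (\<pi> ^^ j) p)" if "i \<in> {1..n}" "a i \<noteq> 0" for i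
      using all that by (auto simp: C_def)
    show ?thesis
    proof (cases "C = {}")
      case True
      then have "s + 1 \<le> n \<and> E_perm n \<pi> a \<cong>\<^sub>A EN (s + 1) \<oplus>\<^sub>A Czero (n - (s + 1))"
        using E_perm_chain[where a = a and s = s, OF \<pi> p chain] supp by blast
      then show ?thesis by (intro disjI2 disjI1 bexI[of _ "s + 1"]) auto
    next
      case False
      then obtain l where "l \<in> C" by blast
      then have "s + 2 \<le> n \<and> E_perm n \<pi> a \<cong>\<^sub>A ES1 \<oplus>\<^sub>A EN (s + 1) \<oplus>\<^sub>A Czero (n - (s + 1) - 1)"
        using E_perm_loop_chain[where a = a and s = s, OF \<pi> p C_loop chain] supp C_unique by blast
      moreover then have "s + 1 \<in> {2..n - 1}" using s by auto
      ultimately show ?thesis by blast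
    qed
  next
    case False
    show ?thesis
    proof (cases "C = {}")
      case True
      have "1 \<in> {1..n}" using n by simp
      then have "E_perm n \<pi> a \<cong>\<^sub>A EN (0 + 1) \<oplus>\<^sub>A Czero (n - (0 + 1))"
        using E_perm_chain[OF \<pi>, of 1 0 a] False True by auto
      then show ?thesis using n by (intro disjI2 disjI1 bexI[of _ "0 + 1"]) auto
    next
      case (False)
      then obtain l where "l \<in> C" by blast
      then have "E_perm n \<pi> a \<cong>\<^sub>A ES1 \<oplus>\<^sub>A Czero (n - 1)"
        using E_perm_loop[where a = a and l = l, OF \<pi> C_loop] C_unique \<open>\<not> (\<exists>i\<in>{1..n}. a i \<noteq> 0 \<and> i \<notin> C)\<close> by blast
      then show ?thesis by blast
    qed
  qed
qed

theorem proposition3p6: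
  fixes n :: nat and \<pi> :: "nat \<Rightarrow> nat" and a :: "nat \<Rightarrow> complex"
  assumes "n \<ge> 1" and "\<pi> permutes {1..n}"
  shows "(condition_P (E_perm n \<pi> a) \<longrightarrow>
            E_perm n \<pi> a \<cong>\<^sub>A ES1 \<oplus>\<^sub>A Czero (n - 1) \<or>
            (\<exists>s\<in>{1..n}. E_perm n \<pi> a \<cong>\<^sub>A EN s \<oplus>\<^sub>A Czero (n - s)) \<or>
            (\<exists>s\<in>{2..n-1}. E_perm n \<pi> a \<cong>\<^sub>A ES1 \<oplus>\<^sub>A EN s \<oplus>\<^sub>A Czero (n - s - 1))) \<and>
         (\<forall>s\<in>{1..n}. \<not> ES1 \<oplus>\<^sub>A Czero (n - 1) \<cong>\<^sub>A EN s \<oplus>\<^sub>A Czero (n - s)) \<and>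
         (\<forall>s\<in>{2..n-1}. \<not> ES1 \<oplus>\<^sub>A Czero (n - 1) \<cong>\<^sub>A ES1 \<oplus>\<^sub>A EN s \<oplus>\<^sub>A Czero (n - s - 1)) \<and>
         (\<forall>s\<in>{1..n}. \<forall>t\<in>{2..n-1}.
            \<not> EN s \<oplus>\<^sub>A Czero (n - s) \<cong>\<^sub>A ES1 \<oplus>\<^sub>A EN t \<oplus>\<^sub>A Czero (n - t - 1)) \<and>
         (\<forall>s\<in>{1..n}. \<forall>t\<in>{1..n}. s \<noteq> t \<longrightarrow>
            \<not> EN s \<oplus>\<^sub>A Czero (n - s) \<cong>\<^sub>A EN t \<oplus>\<^sub>A Czero (n - t)) \<and>
         (\<forall>s\<in>{2..n-1}. \<forall>t\<in>{2..n-1}. s \<noteq> t \<longrightarrow>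
            \<not> ES1 \<oplus>\<^sub>A EN s \<oplus>\<^sub>A Czero (n - s - 1) \<cong>\<^sub>A ES1 \<oplus>\<^sub>A EN t \<oplus>\<^sub>A Czero (n - t - 1))"
proof (intro conjI ballI impI)
  fix s t
  show "\<not> ES1 \<oplus>\<^sub>A Czero (n - 1) \<cong>\<^sub>A EN s \<oplus>\<^sub>A Czero (n - s)" if "s \<in> {1..n}"
    using that by (intro models_non_isomorphic) auto
  show "\<not> ES1 \<oplus>\<^sub>A Czero (n - 1) \<cong>\<^sub>A ES1 \<oplus>\<^sub>A EN s \<oplus>\<^sub>A Czero (n - s - 1)" if "s \<in> {2..n-1}"
    using that by (intro models_non_isomorphic) auto
  show "\<not> EN s \<oplus>\<^sub>A Czero (n - s) \<cong>\<^sub>A ES1 \<oplus>\<^sub>A EN t \<oplus>\<^sub>A Czero (n - t - 1)"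
    if "s \<in> {1..n}" "t \<in> {2..n-1}"
    using that by (intro models_non_isomorphic) auto
  show "\<not> EN s \<oplus>\<^sub>A Czero (n - s) \<cong>\<^sub>A EN t \<oplus>\<^sub>A Czero (n - t)"
    if "s \<in> {1..n}" "t \<in> {1..n}" "s \<noteq> t"
    using that by (intro models_non_isomorphic) auto
  show "\<not> ES1 \<oplus>\<^sub>A EN s \<oplus>\<^sub>A Czero (n - s - 1) \<cong>\<^sub>A ES1 \<oplus>\<^sub>A EN t \<oplus>\<^sub>A Czero (n - t - 1)"
    if "s \<in> {2..n-1}" "t \<in> {2..n-1}" "s \<noteq> t"
    using that by (intro models_non_isomorphic) auto
qed (rule condition_P_classification[OF assms])

end
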